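(* Let $\Lambda=\mathcal KQ/\langle\rho\rangle$ be a string algebra with $Q_1\ne\emptyset$. Let $\mathsf M_{\Lambda\delta}$ be the associated multi-entry inverse automaton over the alphabet $\{0\}$, and let $Q_{\mathsf M_{\Lambda\delta}}$ and $\rho_{\mathsf M_{\Lambda\delta}}$ be the quiver and the set of relations constructed from it. Then $\mathcal KQ_{\mathsf M_{\Lambda\delta}}/\langle\rho_{\mathsf M_{\Lambda\delta}}\rangle\cong\Lambda$.
   Context: $\mathcal K$ is an algebraically closed field. **String algebras.** $Q=(Q_0,Q_1,s,t)$ is a finite quiver; a path $\alpha\beta$ requires $t(\alpha)=s(\beta)$. A string algebra is a monomial algebra $\mathcal KQ/\langle\rho\rangle$, $\rho$ a finite set of paths of length $\ge 2$, such that: (I) each vertex is the source of at most two arrows and the target of at most two arrows; (II) for each $\alpha\in Q_1$ there is at most one arrow $\gamma$ such that $\alpha\gamma$ is a path not in $\rho$, and at most one arrow $\gamma'$ such that $\gamma'\alpha$ is a path not in $\rho$; (III) there is a bound on the lengths of paths having no subpath in $\rho$. Fix maps $\varsigma,\varepsilon:Q_1\to\{-1,1\}$ with: (a) $\alpha\ne\beta$, $s(\alpha)=s(\beta)$ imply $\varsigma(\alpha)=-\varsigma(\beta)$; (b) $\alpha\ne\beta$, $t(\alpha)=t(\beta)$ imply $\varepsilon(\alpha)=-\varepsilon(\beta)$; (c) $t(\alpha)=s(\beta)$, $\alpha\beta\notin\rho$ imply $\varepsilon(\alpha)=-\varsigma(\beta)$. **Strings.** Each arrow $\alpha$ has a formal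 inverse $\alpha^{-1}$, with $(\alpha^{-1})^{-1}=\alpha$, $s(\alpha^{-1})=t(\alpha)$, $t(\alpha^{-1})=s(\alpha)$, $\varsigma(\alpha^{-1})=\varepsilon(\alpha)$, $\varepsilon(\alpha^{-1})=\varsigma(\alpha)$. Elements of $Q_1\sqcup Q_1^{-1}$ are syllables. A finite string of length $k\ge1$ is a sequence of syllables $\alpha_1\cdots\alpha_k$ with $t(\alpha_i)=s(\alpha_{i+1})$, $\alpha_i\ne\alpha_{i+1}^{-1}$ for $1\le i<k$, and neither $\alpha_i\cdots\alpha_{i+j}$ nor $\alpha_{i+j}^{-1}\cdots\alpha_i^{-1}$ in $\rho$ for all $1\le i\le i+j\le k$. Its inverse is $\alpha_k^{-1}\cdots\alpha_1^{-1}$. For each $v\in Q_0$ there are also two zero-length strings $1_{(v,1)},1_{(v,-1)}$ with source and target $v$, $1_{(v,i)}^{-1}=1_{(v,-i)}$, $\varsigma(1_{(v,i)})=-i$, $\varepsilon(1_{(v,i)})=i$. Set $\varsigma(\alpha_1\cdots\alpha_k)=\varsigma(\alpha_1)$, $\varepsilon(\alpha_1\cdots\alpha_k)=\varepsilon(\alpha_k)$, and similarly for source and target. $1_{(v,i)}\mathfrak x$ is defined (and equals $\mathfrak x$) iff $s(\mathfrak x)=v$, $\varsigma(\mathfrak x)=-i$; $\mathfrak x1_{(v,i)}$ is defined (and equals $\mathfrak x$) iff $t(\mathfrak x)=v$, $\varepsilon(\mathfrak x)=i$. A string $\mathfrak y$ is a left (right) substring of $\mathfrak x$ if $\mathfrak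 x=\mathfrak y\mathfrak u$ ($\mathfrak x=\mathfrak u\mathfrak y$) for some string $\mathfrak u$, and is proper if $\mathfrak y\ne\mathfrak x$; the same terms are used for initial (final) parts of paths in $\rho$ and their inverses. **Multi-entry inverse automaton (MIA).** A tuple $\mathsf M=(\mathsf M_0,\mathsf I,\mathsf e,(-)^{-1},\mathsf A,\mathsf t)$ with $\mathsf M_0$ a finite set of states, $\mathsf I\subseteq\mathsf M_0$ the initial states, $\mathsf e:\mathsf M_0\to\mathsf I$, $(-)^{-1}:\mathsf I\to\mathsf I$, $\mathsf A$ a finite alphabet with $\mathsf A^\pm=\mathsf A\sqcup\mathsf A^{-1}$ (formal inverses), and a partial function $\mathsf t:\mathsf M_0\times\mathsf A^\pm\rightharpoonup\mathsf M_0$ such that: (1) $(-)^{-1}$ is an involution without fixed points; (2) $\mathsf e(v)=v$ for $v\in\mathsf I$; (3) if $\mathsf t(v,\mathsf b)$ is defined then $\mathsf t(\mathsf e(v),\mathsf b)$ is defined and $\mathsf e(\mathsf t(v,\mathsf b))=\mathsf e(\mathsf t(\mathsf e(v),\mathsf b))$. $\widetilde{\mathsf t}$ is the extension of $\mathsf t$ to finite words: $\widetilde{\mathsf t}(v,\epsilon)=v$ for the empty word $\epsilon$, $\widetilde{\mathsf t}(v,\mathsf w'\mathsf b)=\mathsf t(\widetilde{\mathsf t}(v,\mathsf w'),\mathsf b)$. **The MIA $\mathsf M_\Lambda$.** Its alphabet is $Q_1$; its initial states are the zero-length strings, with $(-)^{-1}$ given by $1_{(v,i)}^{-1}=1_{(v,-i)}$;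 its states are the zero-length strings, all syllables in $Q_1\sqcup Q_1^{-1}$, and all strings $\mathfrak y$ that are proper left substrings of some $\mathfrak r$ with $\mathfrak r\in\rho$ or $\mathfrak r^{-1}\in\rho$; $\mathsf t_\Lambda(\mathfrak x,\mathsf b)$ is defined iff $\mathfrak x\mathsf b$ is a string, and then it is the maximal right substring of $\mathfrak x\mathsf b$ that is a state; $\mathsf e_\Lambda(\mathfrak x)=1_{(t(\mathfrak x),\varepsilon(\mathfrak x))}$. **The MIA $\mathsf M_{\Lambda\delta}$.** Let $\delta:Q_1\to\{0\}$ be the constant map, write $1:=0^{-1}$, and let $\delta^\pm:Q_1\sqcup Q_1^{-1}\to\{0,1\}$ be the induced map ($\delta^\pm(\alpha)=0$, $\delta^\pm(\alpha^{-1})=1$ for $\alpha\in Q_1$). For each state $\mathfrak x$ of $\mathsf M_\Lambda$, $\delta^\pm$ is injective on $\{\mathsf b:\mathsf t_\Lambda(\mathfrak x,\mathsf b)\text{ defined}\}$. $\mathsf M_{\Lambda\delta}$ has the same states, initial states, $\mathsf e$ and $(-)^{-1}$ as $\mathsf M_\Lambda$, alphabet $\{0\}$, and transition function $\mathsf t'(\mathfrak x,\delta^\pm(\mathsf b))=\mathsf t_\Lambda(\mathfrak x,\mathsf b)$ whenever the latter is defined (and undefined otherwise). **Quiver and relations from an MIA over $\{0\}$.** Let $\mathsf M=(\mathsf M_0,\mathsf I,\mathsf e,(-)^{-1},\{0\},\mathsf t)$ be an MIA. Let $\approx$ be the smallest equivalence relation on $\mathsf I$ with $v\approx v^{-1}$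 for all $v\in\mathsf I$. The quiver $Q_{\mathsf M}$ has vertex set $\mathsf I/{\approx}$, and the number of arrows from $[v]_\approx$ to $[v']_\approx$ is the cardinality of the set $\{(v_1,v_1')\in\mathsf I\times\mathsf I: v_1\approx v,\ v_1'\approx v',\ v_1'=\mathsf e(\mathsf t(v_1,0))\}$ (where $\mathsf t(v_1,0)$ is required to be defined); the arrow $[v]_\approx\to[v']_\approx$ contributed by $v_1'=\mathsf e(\mathsf t(v_1,0))$ is denoted $a_{(v_1,v_1')}$. The set of relations is $$\rho_{\mathsf M}=\{p=a_{(v_1,v_1')}a_{(v_2,v_2')}\cdots a_{(v_k,v_k')}: p\text{ is a path in }Q_{\mathsf M},\ k\ge2,\text{ and }\widetilde{\mathsf t}(v_1,0^k)\text{ is undefined}\}.$$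
   Formalization: The set of relations is corrected: a path a_(v1,v1')...a_(vk,vk') with k≥2 is also a relation when v_i' ≠ v_(i+1) for some i<k; with the displayed formula alone the claim fails, e.g. for arrows α:1→2, β:2→3, γ:2→4 and ρ={αβ}. *)

theory Defs
  imports
    "HOL-Computational_Algebra.Polynomial"
    "HOL-Library.Poly_Mapping"
    "HOL-Library.Sublist"
    "Graph_Theory.Arc_Walk"
    "HOL-Algebra.QuotRing"
    "HOL-Algebra.Module"
begin

section \<open>Path algebras and their quotients\<close>

text \<open>
  A quiver is a \<open>pre_digraph\<close> (with loops and parallel arrows allowed); the source of an arrow
  is its \<open>tail\<close> and its target is its \<open>head\<close>. Paths compose from left to right, as arc lists do.
  A path is a pair of its starting vertex and its list of arrows, so that the
  trivial path at \<open>v\<close> is \<open>(v, [])\<close>.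
\<close>

definition quiver_paths :: "('v, 'a) pre_digraph \<Rightarrow> ('v \<times> 'a list) set" where
  "quiver_paths Q = {(u, p). \<exists>v. pre_digraph.awalk Q u p v}"

definition path_end :: "('v, 'a) pre_digraph \<Rightarrow> 'v \<times> 'a list \<Rightarrow> 'v" where
  "path_end Q p = last (pre_digraph.awalk_verts Q (fst p) (snd p))"

definition arcs_path :: "('v, 'a) pre_digraph \<Rightarrow> 'a list \<Rightarrow> 'v \<times> 'a list" where
  "arcs_path Q w = (tail Q (hd w), w)"

definition path_algebra ::
  "('v, 'a) pre_digraph \<Rightarrow> ('k::field, ('v \<times> 'a list) \<Rightarrow>\<^sub>0 'k) module" where
  "path_algebra Q =
     \<lparr>carrier = {f. Poly_Mapping.keys f \<subseteq> quiver_paths Q},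
      mult = (\<lambda>f g. \<Sum>p \<in> Poly_Mapping.keys f. \<Sum>q \<in> Poly_Mapping.keys g.
                if path_end Q p = fst q
                then Poly_Mapping.single (fst p, snd p @ snd q)
                       (Poly_Mapping.lookup f p * Poly_Mapping.lookup g q)
                else 0),
      one = (\<Sum>v \<in> verts Q. Poly_Mapping.single (v, []) 1),
      zero = 0,
      add = (+),
      smult = (\<lambda>c f. Poly_Mapping.map ((*) c) f)\<rparr>"

text \<open>
  The quotient ring \<open>A Quot I\<close> equipped with the induced scalar multiplication
  \<open>c (I + x) = I + c x\<close>, written in the style of \<open>rcoset_mult\<close>.
\<close>

definition quot_algebra :: "('k, 'm) module \<Rightarrow> 'm set \<Rightarrow> ('k, 'm set) module" where
  "quot_algebra A I =
     ring.extend (A Quot I)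
       (module.fields (\<lambda>c X. \<Union>x\<in>X. I +>\<^bsub>A\<^esub> (c \<odot>\<^bsub>A\<^esub> x)))"

text \<open>\<open>bound_quiver_algebra Q \<rho>\<close> is the algebra \<open>KQ/\<langle>\<rho>\<rangle>\<close>, for \<open>\<rho>\<close> a set of paths of positive length.\<close>

definition bound_quiver_algebra ::
  "('v, 'a) pre_digraph \<Rightarrow> 'a list set \<Rightarrow> ('k::field, (('v \<times> 'a list) \<Rightarrow>\<^sub>0 'k) set) module" where
  "bound_quiver_algebra Q \<rho> =
     quot_algebra (path_algebra Q)
       (genideal (path_algebra Q) ((\<lambda>w. Poly_Mapping.single (arcs_path Q w) 1) ` \<rho>))"

definition alg_iso :: "('k, 'm) module \<Rightarrow> ('k, 'n) module \<Rightarrow> ('m \<Rightarrow> 'n) set" where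
  "alg_iso A B =
     {\<phi> \<in> ring_iso A B. \<forall>c. \<forall>x \<in> carrier A. \<phi> (c \<odot>\<^bsub>A\<^esub> x) = c \<odot>\<^bsub>B\<^esub> \<phi> x}"

definition alg_isomorphic :: "('k, 'm) module \<Rightarrow> ('k, 'n) module \<Rightarrow> bool"
    (infix \<open>\<cong>\<^sub>a\<^sub>l\<^sub>g\<close> 60) where
  "A \<cong>\<^sub>a\<^sub>l\<^sub>g B \<longleftrightarrow> alg_iso A B \<noteq> {}"


section \<open>String algebras\<close>

locale string_algebra = fin_digraph Q
  for Q :: "('v, 'a) pre_digraph" +
  fixes \<rho> :: "'a list set"
  assumes finite_rel: "finite \<rho>"
    and rel_path: "w \<in> \<rho> \<Longrightarrow> \<exists>u v. awalk u w v"
    and rel_length: "w \<in> \<rho> \<Longrightarrow> 2 \<le> length w"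
    and at_most_two_out: "v \<in> verts Q \<Longrightarrow> out_degree Q v \<le> 2"
    and at_most_two_in: "v \<in> verts Q \<Longrightarrow> in_degree Q v \<le> 2"
    and unique_right: "\<alpha> \<in> arcs Q \<Longrightarrow>
      \<exists>\<^sub>\<le>\<^sub>1 \<gamma>. \<gamma> \<in> arcs Q \<and> head Q \<alpha> = tail Q \<gamma> \<and> [\<alpha>, \<gamma>] \<notin> \<rho>"
    and unique_left: "\<alpha> \<in> arcs Q \<Longrightarrow>
      \<exists>\<^sub>\<le>\<^sub>1 \<gamma>. \<gamma> \<in> arcs Q \<and> head Q \<gamma> = tail Q \<alpha> \<and> [\<gamma>, \<alpha>] \<notin> \<rho>"
    and bounded: "\<exists>N. \<forall>u w v. awalk u w v \<and> (\<forall>r \<in> \<rho>. \<not> sublist r w) \<longrightarrow> length w \<le> N"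

locale signed_string_algebra = string_algebra Q \<rho>
  for Q :: "('v, 'a) pre_digraph" and \<rho> :: "'a list set" +
  fixes \<sigma> \<epsilon> :: "'a \<Rightarrow> int"
  assumes sigma_sign: "\<alpha> \<in> arcs Q \<Longrightarrow> \<sigma> \<alpha> \<in> {-1, 1}"
    and eps_sign: "\<alpha> \<in> arcs Q \<Longrightarrow> \<epsilon> \<alpha> \<in> {-1, 1}"
    and sigma_source: "\<alpha> \<in> arcs Q \<Longrightarrow> \<beta> \<in> arcs Q \<Longrightarrow> \<alpha> \<noteq> \<beta> \<Longrightarrow>
      tail Q \<alpha> = tail Q \<beta> \<Longrightarrow> \<sigma> \<alpha> = - \<sigma> \<beta>"
    and eps_target: "\<alpha> \<in> arcs Q \<Longrightarrow> \<beta> \<in> arcs Q \<Longrightarrow> \<alpha> \<noteq> \<beta> \<Longrightarrow>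
      head Q \<alpha> = head Q \<beta> \<Longrightarrow> \<epsilon> \<alpha> = - \<epsilon> \<beta>"
    and eps_sigma: "\<alpha> \<in> arcs Q \<Longrightarrow> \<beta> \<in> arcs Q \<Longrightarrow> head Q \<alpha> = tail Q \<beta> \<Longrightarrow>
      [\<alpha>, \<beta>] \<notin> \<rho> \<Longrightarrow> \<epsilon> \<alpha> = - \<sigma> \<beta>"


section \<open>Strings\<close>

datatype 'a syllable = Dir 'a | Inv 'a

fun syl_inv :: "'a syllable \<Rightarrow> 'a syllable" where
  "syl_inv (Dir a) = Inv a"
| "syl_inv (Inv a) = Dir a"

definition word_inv :: "'a syllable list \<Rightarrow> 'a syllable list" where
  "word_inv w = rev (map syl_inv w)"

definition syllables :: "'a set \<Rightarrow> 'a syllable set" where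
  "syllables A = Dir ` A \<union> Inv ` A"

text \<open>\<open>Triv v i\<close> is the zero-length string \<open>1\<close> indexed by \<open>(v, i)\<close>.\<close>

datatype ('v, 'a) strng = Triv 'v int | Word "'a syllable list"

fun str_length :: "('v, 'a) strng \<Rightarrow> nat" where
  "str_length (Triv v i) = 0"
| "str_length (Word w) = length w"

fun str_inv :: "('v, 'a) strng \<Rightarrow> ('v, 'a) strng" where
  "str_inv (Triv v i) = Triv v (- i)"
| "str_inv (Word w) = Word (word_inv w)"

context signed_string_algebra
begin

fun syl_source :: "'a syllable \<Rightarrow> 'v" where
  "syl_source (Dir a) = tail Q a"
| "syl_source (Inv a) = head Q a"

fun syl_target :: "'a syllable \<Rightarrow> 'v" where
  "syl_target (Dir a) = head Q a"
| "syl_target (Inv a) = tail Q a"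

fun syl_sigma :: "'a syllable \<Rightarrow> int" where
  "syl_sigma (Dir a) = \<sigma> a"
| "syl_sigma (Inv a) = \<epsilon> a"

fun syl_eps :: "'a syllable \<Rightarrow> int" where
  "syl_eps (Dir a) = \<epsilon> a"
| "syl_eps (Inv a) = \<sigma> a"

fun str_source :: "('v, 'a) strng \<Rightarrow> 'v" where
  "str_source (Triv v i) = v"
| "str_source (Word w) = syl_source (hd w)"

fun str_target :: "('v, 'a) strng \<Rightarrow> 'v" where
  "str_target (Triv v i) = v"
| "str_target (Word w) = syl_target (last w)"

fun str_sigma :: "('v, 'a) strng \<Rightarrow> int" where
  "str_sigma (Triv v i) = - i"
| "str_sigma (Word w) = syl_sigma (hd w)"

fun str_eps :: "('v, 'a) strng \<Rightarrow> int" where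
  "str_eps (Triv v i) = i"
| "str_eps (Word w) = syl_eps (last w)"

definition zero_strings :: "('v, 'a) strng set" where
  "zero_strings = {Triv v i | v i. v \<in> verts Q \<and> i \<in> {-1, 1}}"

definition rel_words :: "'a syllable list set" where
  "rel_words = map Dir ` \<rho>"

definition is_string_word :: "'a syllable list \<Rightarrow> bool" where
  "is_string_word w \<longleftrightarrow>
     w \<noteq> [] \<and> set w \<subseteq> syllables (arcs Q) \<and>
     (\<forall>i. Suc i < length w \<longrightarrow>
        syl_target (w ! i) = syl_source (w ! Suc i) \<and> w ! i \<noteq> syl_inv (w ! Suc i)) \<and>
     (\<forall>y. sublist y w \<longrightarrow> y \<notin> rel_words \<and> word_inv y \<notin> rel_words)"

definition strings :: "('v, 'a) strng set" where
  "strings = zero_strings \<union> Word ` {w. is_string_word w}"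

text \<open>Concatenation of two strings, \<open>None\<close> where it is undefined.\<close>

fun str_conc :: "('v, 'a) strng \<Rightarrow> ('v, 'a) strng \<Rightarrow> ('v, 'a) strng option" where
  "str_conc (Triv v i) x = (if str_source x = v \<and> str_sigma x = - i then Some x else None)"
| "str_conc (Word w) (Triv v i) =
     (if str_target (Word w) = v \<and> str_eps (Word w) = i then Some (Word w) else None)"
| "str_conc (Word w) (Word w') = (if is_string_word (w @ w') then Some (Word (w @ w')) else None)"

definition right_substring :: "('v, 'a) strng \<Rightarrow> ('v, 'a) strng \<Rightarrow> bool" where
  "right_substring y x \<longleftrightarrow> y \<in> strings \<and> (\<exists>u \<in> strings. str_conc u y = Some x)"

end


section \<open>Multi-entry inverse automata\<close>

text \<open>
  The alphabet \<open>A\<close> together with its formal inverses is \<open>syllables A\<close>; undefined transitions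
  are \<open>None\<close>.
\<close>

record ('s, 'b) mia_data =
  states :: "'s set"
  initials :: "'s set"
  entry :: "'s \<Rightarrow> 's"
  opp :: "'s \<Rightarrow> 's"
  alphabet :: "'b set"
  step :: "'s \<Rightarrow> 'b syllable \<Rightarrow> 's option"

locale mia =
  fixes M :: "('s, 'b) mia_data"
  assumes finite_states: "finite (states M)"
    and initials_states: "initials M \<subseteq> states M"
    and entry_initial: "x \<in> states M \<Longrightarrow> entry M x \<in> initials M"
    and finite_alphabet: "finite (alphabet M)"
    and step_dom: "step M x b = Some y \<Longrightarrow>
      x \<in> states M \<and> b \<in> syllables (alphabet M) \<and> y \<in> states M"
    and opp_initial: "v \<in> initials M \<Longrightarrow> opp M v \<in> initials M"
    and opp_opp: "v \<in> initials M \<Longrightarrow> opp M (opp M v) = v"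
    and opp_no_fixpoint: "v \<in> initials M \<Longrightarrow> opp M v \<noteq> v"
    and entry_id: "v \<in> initials M \<Longrightarrow> entry M v = v"
    and entry_step: "step M x b = Some y \<Longrightarrow>
      \<exists>z. step M (entry M x) b = Some z \<and> entry M y = entry M z"

definition step_word :: "('s, 'b) mia_data \<Rightarrow> 's \<Rightarrow> 'b syllable list \<Rightarrow> 's option" where
  "step_word M x w = foldl (\<lambda>y b. Option.bind y (\<lambda>z. step M z b)) (Some x) w"

definition mia_equiv :: "('s, 'b) mia_data \<Rightarrow> ('s \<times> 's) set" where
  "mia_equiv M = \<Inter>{r. equiv (initials M) r \<and> (\<forall>v \<in> initials M. (v, opp M v) \<in> r)}"

text \<open>The arrow \<open>a\<close> indexed by \<open>(v, v')\<close> is the pair \<open>(v, v')\<close> itself.\<close>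

definition mia_quiver :: "('s, 'b::zero) mia_data \<Rightarrow> ('s set, 's \<times> 's) pre_digraph" where
  "mia_quiver M =
     \<lparr>verts = initials M // mia_equiv M,
      arcs = {(v, v'). v \<in> initials M \<and> v' \<in> initials M \<and>
                (\<exists>y. step M v (Dir 0) = Some y \<and> v' = entry M y)},
      tail = (\<lambda>(v, v'). mia_equiv M `` {v}),
      head = (\<lambda>(v, v'). mia_equiv M `` {v'})\<rparr>"

text \<open>
  A path \<open>p\<close> of length at least two is a relation iff \<open>M\<close>, started in the first initial state
  of \<open>p\<close>, cannot read \<open>0\<close> repeatedly along \<open>p\<close>: either the run of \<open>length p\<close> steps is
  undefined, or \<open>p\<close> passes at some vertex from the initial state \<open>v\<close> at which an arrow ends to the
  opposite state \<open>opp M v\<close>, which is the same vertex of the quiver, so that the run does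
  not follow \<open>p\<close>.

  The paper's formula for the relations displays the first alternative only, which depends
  just on the first arrow and the length of \<open>p\<close>. The second one is needed: for the
  string algebra with arrows \<open>\<alpha> : 1 \<rightarrow> 2\<close>, \<open>\<beta> : 2 \<rightarrow> 3\<close>, \<open>\<gamma> : 2 \<rightarrow> 4\<close> and the relation \<open>\<alpha>\<beta>\<close>, the
  word \<open>00\<close> can be read from the initial state of \<open>\<alpha>\<close>, namely along \<open>\<alpha>\<gamma>\<close>, so that the first
  alternative alone yields no relations, although \<open>\<alpha>\<beta>\<close> is one.
\<close>

definition mia_relations :: "('s, 'b::zero) mia_data \<Rightarrow> ('s \<times> 's) list set" where
  "mia_relations M =
     {p. (\<exists>u v. pre_digraph.awalk (mia_quiver M) u p v) \<and> 2 \<le> length p \<and>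
         (step_word M (fst (hd p)) (replicate (length p) (Dir 0)) = None \<or>
          (\<exists>i. Suc i < length p \<and> snd (p ! i) \<noteq> fst (p ! Suc i)))}"


section \<open>The automata of a string algebra\<close>

context signed_string_algebra
begin

text \<open>
  The elements of \<open>\<rho>\<close> and their inverses are not strings, so that their proper left
  substrings are taken on the level of words; those that are not strings
  themselves are discarded. The empty left substrings are zero-length strings.
\<close>

definition string_states :: "('v, 'a) strng set" where
  "string_states =
     zero_strings \<union> {Word [b] | b. b \<in> syllables (arcs Q)} \<union>
     {Word y | y. Word y \<in> strings \<and>
        (\<exists>r. (r \<in> rel_words \<or> word_inv r \<in> rel_words) \<and> strict_prefix y r)}"

definition string_mia :: "(('v, 'a) strng, 'a) mia_data" where
  "string_mia =
     \<lparr>states = string_states,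
      initials = zero_strings,
      entry = (\<lambda>x. Triv (str_target x) (str_eps x)),
      opp = str_inv,
      alphabet = arcs Q,
      step = (\<lambda>x b.
        if x \<in> string_states \<and> b \<in> syllables (arcs Q) then
          (case str_conc x (Word [b]) of
             None \<Rightarrow> None
           | Some z \<Rightarrow> Some (ARG_MAX str_length y. y \<in> string_states \<and> right_substring y z))
        else None)\<rparr>"

definition delta :: "'a \<Rightarrow> nat" where
  "delta = (\<lambda>\<alpha>. 0)"

definition delta_mia :: "(('v, 'a) strng, nat) mia_data" where
  "delta_mia =
     \<lparr>states = states string_mia,
      initials = initials string_mia,
      entry = entry string_mia,
      opp = opp string_mia,
      alphabet = {0},
      step = (\<lambda>x c.
        if \<exists>b. map_syllable delta b = c \<and> step string_mia x b \<noteq> None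
        then step string_mia x (THE b. map_syllable delta b = c \<and> step string_mia x b \<noteq> None)
        else None)\<rparr>"

end

end

theory Submission
  imports Defs "Graph_Theory.Digraph_Isomorphism"
begin

text \<open>
  The two quivers are the same up to renaming, and under this renaming the relations of the
  automaton are exactly the paths of \<open>Q\<close> that contain an element of \<open>\<rho>\<close>. Such a set of paths
  generates the same ideal as \<open>\<rho>\<close>, whence the isomorphism of the quotient algebras.

  \<^emph>\<open>Quivers.\<close> A vertex \<open>v\<close> corresponds to the pair of the two zero-length strings at \<open>v\<close>. From the
  zero-length string \<open>1\<close> indexed by \<open>(v, i)\<close> the automaton can read a direct syllable \<open>\<alpha>\<close> iff \<open>\<alpha>\<close>
  starts at \<open>v\<close> and has \<open>\<sigma> \<alpha> = - i\<close>. Since \<open>\<sigma>\<close> separates the arrows with a common source, there is at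
  most one such \<open>\<alpha>\<close> for each initial state, and every arrow \<open>\<alpha>\<close> arises from exactly one initial
  state. So the arrows of the quiver of the automaton are the pairs
  \<open>(Triv (tail Q \<alpha>) (- \<sigma> \<alpha>), Triv (head Q \<alpha>) (\<epsilon> \<alpha>))\<close> (lemmas \<open>arcs_mia_quiver\<close>,
  \<open>app_iso_string_iso\<close>).

  \<^emph>\<open>Relations.\<close> Along a path without subpath in \<open>\<rho>\<close> the signs of consecutive arrows match, and the
  automaton behaves as an Aho-Corasick machine: after reading the path, its state is the longest
  suffix of the path that is a state. Such a state remembers every suffix of the path that is a
  nonempty proper prefix of a relation, hence the next arrow can be read iff the longer path still has no
  subpath in \<open>\<rho>\<close> (lemma \<open>string_step_Word\<close>). There is at most one such next arrow, so the letter
  \<open>0\<close> determines it, and the run on a power of \<open>0\<close> follows the given path as long as this path has no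
  subpath in \<open>\<rho>\<close>. Conversely, a run that is defined passes along some path without subpath
  in \<open>\<rho>\<close>, and matching signs force this path to be the given one (lemmas \<open>run_permitted\<close>,
  \<open>permitted_if_run\<close>, \<open>mia_relations_iff\<close>).

  \<^emph>\<open>Algebras.\<close> Path algebras of finite quivers are rings, an isomorphism of quivers extends linearly
  to an isomorphism of path algebras, and this descends to the quotients by corresponding ideals
  (lemma \<open>bound_quiver_algebra_app_iso\<close>).
\<close>

section \<open>The path algebra of a finite quiver is a ring\<close>

text \<open>
  The product of two paths with coefficient \<open>c\<close>. Keeping the coefficient inside makes this a function
  additive in \<open>c\<close>, so that multiplication in the path algebra is a double sum to which additivity
  lemmas for finitely supported functions apply.
\<close>

definition path_product ::
  "('v, 'a) pre_digraph \<Rightarrow> 'v \<times> 'a list \<Rightarrow> 'v \<times> 'a list \<Rightarrow> 'k \<Rightarrow> ('v \<times> 'a list) \<Rightarrow>\<^sub>0 'k::field" where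
  "path_product G p q c =
     (if path_end G p = fst q then Poly_Mapping.single (fst p, snd p @ snd q) c else 0)"

lemma path_product_zero [simp]: "path_product G p q 0 = 0"
  by (simp add: path_product_def)

lemma path_product_add: "path_product G p q (c + d) = path_product G p q c + path_product G p q d"
  by (simp add: path_product_def single_add)

lemma path_algebra_simps:
  "carrier (path_algebra G) = {f. Poly_Mapping.keys f \<subseteq> quiver_paths G}"
  "\<one>\<^bsub>path_algebra G\<^esub> = (\<Sum>v\<in>verts G. Poly_Mapping.single (v, []) 1)"
  "\<zero>\<^bsub>path_algebra G\<^esub> = 0"
  "f \<oplus>\<^bsub>path_algebra G\<^esub> g = f + g"
  "c \<odot>\<^bsub>path_algebra G\<^esub> f = Poly_Mapping.map ((*) c) f"
  by (simp_all add: path_algebra_def)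

lemma path_mult_eq:
  "f \<otimes>\<^bsub>path_algebra G\<^esub> g =
     (\<Sum>p\<in>Poly_Mapping.keys f. \<Sum>q\<in>Poly_Mapping.keys g.
        path_product G p q (Poly_Mapping.lookup f p * Poly_Mapping.lookup g q))"
  by (simp add: path_algebra_def path_product_def)

lemma path_mult_add_left:
  "(f + g) \<otimes>\<^bsub>path_algebra G\<^esub> h = f \<otimes>\<^bsub>path_algebra G\<^esub> h + g \<otimes>\<^bsub>path_algebra G\<^esub> h"
  unfolding path_mult_eq
  using setsum_keys_plus_distrib[where p = f and q = g and
      f = "\<lambda>p c. \<Sum>q\<in>Poly_Mapping.keys h. path_product G p q (c * Poly_Mapping.lookup h q)"]
  by (simp add: distrib_right path_product_add sum.distrib)

lemma path_mult_add_right: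
  "h \<otimes>\<^bsub>path_algebra G\<^esub> (f + g) = h \<otimes>\<^bsub>path_algebra G\<^esub> f + h \<otimes>\<^bsub>path_algebra G\<^esub> g"
proof -
  have "(\<Sum>q\<in>Poly_Mapping.keys (f + g).
           path_product G p q (Poly_Mapping.lookup h p * Poly_Mapping.lookup (f + g) q)) =
        (\<Sum>q\<in>Poly_Mapping.keys f.
           path_product G p q (Poly_Mapping.lookup h p * Poly_Mapping.lookup f q)) +
        (\<Sum>q\<in>Poly_Mapping.keys g.
           path_product G p q (Poly_Mapping.lookup h p * Poly_Mapping.lookup g q))" for p
    using setsum_keys_plus_distrib[where p = f and q = g and
        f = "\<lambda>q c. path_product G p q (Poly_Mapping.lookup h p * c)"]
    by (simp add: distrib_left path_product_add)
  then show ?thesis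
    by (simp add: path_mult_eq sum.distrib)
qed

lemma path_mult_zero [simp]:
  "0 \<otimes>\<^bsub>path_algebra G\<^esub> f = 0" "f \<otimes>\<^bsub>path_algebra G\<^esub> 0 = 0"
  by (simp_all add: path_mult_eq)

lemma path_mult_single:
  "Poly_Mapping.single p a \<otimes>\<^bsub>path_algebra G\<^esub> Poly_Mapping.single q b = path_product G p q (a * b)"
  by (simp add: path_mult_eq)

lemma path_mult_sum_left:
  "(\<Sum>i\<in>I. f i) \<otimes>\<^bsub>path_algebra G\<^esub> h = (\<Sum>i\<in>I. f i \<otimes>\<^bsub>path_algebra G\<^esub> h)"
  by (induction I rule: infinite_finite_induct) (simp_all add: path_mult_add_left)

lemma path_mult_sum_right:
  "h \<otimes>\<^bsub>path_algebra G\<^esub> (\<Sum>i\<in>I. f i) = (\<Sum>i\<in>I. h \<otimes>\<^bsub>path_algebra G\<^esub> f i)"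
  by (induction I rule: infinite_finite_induct) (simp_all add: path_mult_add_right)

lemma poly_mapping_eq_sum_single:
  "f = (\<Sum>p\<in>Poly_Mapping.keys f. Poly_Mapping.single p (Poly_Mapping.lookup f p))"
proof (rule poly_mapping_eqI)
  fix k
  show "Poly_Mapping.lookup f k = Poly_Mapping.lookup
          (\<Sum>p\<in>Poly_Mapping.keys f. Poly_Mapping.single p (Poly_Mapping.lookup f p)) k"
    by (cases "k \<in> Poly_Mapping.keys f")
       (auto simp: lookup_sum lookup_single when_def sum.delta' in_keys_iff)
qed

text \<open>
  Multiplication, scalar multiplication and the maps induced by quiver isomorphisms are additive,
  so identities between them need to be checked on paths only.
\<close>

lemma path_algebra_induct [consumes 1, case_names zero single add]:
  fixes f :: "('v \<times> 'a list) \<Rightarrow>\<^sub>0 'k::field"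
  assumes "f \<in> carrier (path_algebra G)"
    and zero: "P 0"
    and single: "\<And>p c. p \<in> quiver_paths G \<Longrightarrow> P (Poly_Mapping.single p c)"
    and add: "\<And>f g. P f \<Longrightarrow> P g \<Longrightarrow> P (f + g)"
  shows "P f"
proof -
  have "P (\<Sum>p\<in>A. Poly_Mapping.single p (Poly_Mapping.lookup f p))"
    if "finite A" "A \<subseteq> quiver_paths G" for A
    using that by induction (auto intro: zero single add)
  then have "P (\<Sum>p\<in>Poly_Mapping.keys f. Poly_Mapping.single p (Poly_Mapping.lookup f p))"
    using assms(1) by (simp add: path_algebra_simps)
  then show ?thesis
    by (subst poly_mapping_eq_sum_single)
qed

lemma single_in_path_algebra:
  "p \<in> quiver_paths G \<Longrightarrow> Poly_Mapping.single p c \<in> carrier (path_algebra G)"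
  by (simp add: path_algebra_simps)

lemma add_in_path_algebra:
  "f \<in> carrier (path_algebra G) \<Longrightarrow> g \<in> carrier (path_algebra G) \<Longrightarrow>
   f + g \<in> carrier (path_algebra G)"
  using keys_add[of f g] by (auto simp: path_algebra_simps)

lemma sum_in_path_algebra:
  "(\<And>i. i \<in> I \<Longrightarrow> f i \<in> carrier (path_algebra G)) \<Longrightarrow> sum f I \<in> carrier (path_algebra G)"
  by (induction I rule: infinite_finite_induct)
     (auto intro: add_in_path_algebra, auto simp: path_algebra_simps)

lemma map_times_single:
  "Poly_Mapping.map ((*) c) (Poly_Mapping.single p a) = Poly_Mapping.single p (c * a :: 'k::field)"
  by (rule poly_mapping_eqI) (auto simp: lookup_single map.rep_eq when_def)

lemma map_times_zero: "Poly_Mapping.map ((*) (c :: 'k::field)) 0 = 0"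
  by (rule poly_mapping_eqI) (simp add: map.rep_eq)

lemma map_times_add:
  "Poly_Mapping.map ((*) c) (f + g) = Poly_Mapping.map ((*) c) f + Poly_Mapping.map ((*) (c :: 'k::field)) g"
  by (rule poly_mapping_eqI) (auto simp: lookup_add map.rep_eq when_def distrib_left add_eq_0_iff)

lemma smult_in_path_algebra:
  "f \<in> carrier (path_algebra G) \<Longrightarrow> c \<odot>\<^bsub>path_algebra G\<^esub> f \<in> carrier (path_algebra G)"
  by (auto simp: path_algebra_simps in_keys_iff map.rep_eq when_def subset_iff)

context wf_digraph
begin

lemma path_end_append:
  assumes "path_end G p = fst q"
  shows "path_end G (fst p, snd p @ snd q) = path_end G q"
  using assms unfolding path_end_def awalk_verts_conv by auto

lemma append_quiver_paths:
  assumes "p \<in> quiver_paths G" "q \<in> quiver_paths G" "path_end G p = fst q"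
  shows "(fst p, snd p @ snd q) \<in> quiver_paths G"
  using assms unfolding quiver_paths_def path_end_def
  by (auto intro!: awalk_appendI)

lemma path_end_in_verts: "p \<in> quiver_paths G \<Longrightarrow> path_end G p \<in> verts G"
  unfolding quiver_paths_def path_end_def by (auto intro: awalk_last_in_verts)

lemma path_product_in_path_algebra:
  assumes "p \<in> quiver_paths G" "q \<in> quiver_paths G"
  shows "path_product G p q c \<in> carrier (path_algebra G)"
  using append_quiver_paths[OF assms] by (auto simp: path_product_def path_algebra_simps)

lemma mult_in_path_algebra:
  fixes f g :: "('a \<times> 'b list) \<Rightarrow>\<^sub>0 'k::field"
  assumes "f \<in> carrier (path_algebra G)" "g \<in> carrier (path_algebra G)"
  shows "f \<otimes>\<^bsub>path_algebra G\<^esub> g \<in> carrier (path_algebra G)"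
  using assms unfolding path_mult_eq
  by (intro sum_in_path_algebra path_product_in_path_algebra) (auto simp: path_algebra_simps)

lemma path_mult_assoc_single:
  "path_product G p q a \<otimes>\<^bsub>path_algebra G\<^esub> Poly_Mapping.single r b =
   Poly_Mapping.single p c \<otimes>\<^bsub>path_algebra G\<^esub> path_product G q r d"
  if "a * b = c * d"
  using that path_end_append[of p q]
  by (auto simp: path_product_def path_mult_single)

text \<open>
  By additivity in each factor this reduces to paths; there both bracketings concatenate three lists,
  and both vanish unless the three paths are composable.
\<close>

lemma path_mult_assoc:
  fixes f g h :: "('a \<times> 'b list) \<Rightarrow>\<^sub>0 'k::field"
  assumes "f \<in> carrier (path_algebra G)" "g \<in> carrier (path_algebra G)" "h \<in> carrier (path_algebra G)"
  shows "f \<otimes>\<^bsub>path_algebra G\<^esub> g \<otimes>\<^bsub>path_algebra G\<^esub> h = f \<otimes>\<^bsub>path_algebra G\<^esub> (g \<otimes>\<^bsub>path_algebra G\<^esub> h)"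
  using assms(1)
proof (induction f rule: path_algebra_induct)
  case (single p a)
  show ?case
    using assms(2)
  proof (induction g rule: path_algebra_induct)
    case (single q b)
    show ?case
      using assms(3)
    proof (induction h rule: path_algebra_induct)
      case (single r c)
      show ?case
        by (simp add: path_mult_single path_mult_assoc_single mult.assoc)
    qed (simp_all add: path_mult_add_right)
  qed (simp_all add: path_mult_add_left path_mult_add_right)
qed (simp_all add: path_mult_add_left)

end

context fin_digraph
begin

lemma path_mult_one_left:
  fixes f :: "('a \<times> 'b list) \<Rightarrow>\<^sub>0 'k::field"
  assumes "f \<in> carrier (path_algebra G)"
  shows "\<one>\<^bsub>path_algebra G\<^esub> \<otimes>\<^bsub>path_algebra G\<^esub> f = f"
  using assms
proof (induction f rule: path_algebra_induct)
  case (single p c)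
  then have "fst p \<in> verts G"
    by (auto simp: quiver_paths_def)
  moreover have "path_product G (v, []) p (1 * c) = (if fst p = v then Poly_Mapping.single p c else 0)" for v
    by (auto simp: path_product_def path_end_def)
  ultimately show ?case
    by (simp add: path_algebra_simps path_mult_sum_left path_mult_single sum.delta')
qed (simp_all add: path_mult_add_right)

lemma path_mult_one_right:
  fixes f :: "('a \<times> 'b list) \<Rightarrow>\<^sub>0 'k::field"
  assumes "f \<in> carrier (path_algebra G)"
  shows "f \<otimes>\<^bsub>path_algebra G\<^esub> \<one>\<^bsub>path_algebra G\<^esub> = f"
  using assms
proof (induction f rule: path_algebra_induct)
  case (single p c)
  have "path_product G p (v, []) (c * 1) = (if path_end G p = v then Poly_Mapping.single p c else 0)" for v
    by (auto simp: path_product_def)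
  then show ?case
    using path_end_in_verts[OF single]
    by (simp add: path_algebra_simps path_mult_sum_right path_mult_single sum.delta')
qed (simp_all add: path_mult_add_left)

lemma ring_path_algebra:
  "ring (path_algebra G :: ('k::field, ('a \<times> 'b list) \<Rightarrow>\<^sub>0 'k) module)"
proof (rule ringI)
  show "abelian_group (path_algebra G :: ('k, ('a \<times> 'b list) \<Rightarrow>\<^sub>0 'k) module)"
  proof (rule abelian_groupI)
    fix f :: "('a \<times> 'b list) \<Rightarrow>\<^sub>0 'k"
    assume "f \<in> carrier (path_algebra G)"
    then have "- f \<in> carrier (path_algebra G)"
      by (simp add: path_algebra_simps)
    then show "\<exists>g\<in>carrier (path_algebra G). g \<oplus>\<^bsub>path_algebra G\<^esub> f = \<zero>\<^bsub>path_algebra G\<^esub>"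
      by (intro bexI[of _ "- f"]) (simp add: path_algebra_simps)
  qed (simp_all add: path_algebra_simps(3,4) add_in_path_algebra add.assoc add.commute,
      simp add: path_algebra_simps)
  have "\<one>\<^bsub>path_algebra G\<^esub> \<in> carrier (path_algebra G :: ('k, ('a \<times> 'b list) \<Rightarrow>\<^sub>0 'k) module)"
    unfolding path_algebra_simps(2)
    by (intro sum_in_path_algebra single_in_path_algebra) (auto simp: quiver_paths_def awalk_Nil_iff)
  then show "monoid (path_algebra G :: ('k, ('a \<times> 'b list) \<Rightarrow>\<^sub>0 'k) module)"
    by (intro monoidI) (simp_all add: mult_in_path_algebra path_mult_assoc path_mult_one_left path_mult_one_right)
qed (simp_all add: path_algebra_simps(4) path_mult_add_left path_mult_add_right)

end

section \<open>Isomorphic quivers have isomorphic path algebras\<close>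

text \<open>The linear extension of a map between bases.\<close>

definition push_forward :: "('p \<Rightarrow> 'q) \<Rightarrow> ('p \<Rightarrow>\<^sub>0 'k) \<Rightarrow> ('q \<Rightarrow>\<^sub>0 'k::comm_monoid_add)" where
  "push_forward h f = (\<Sum>p\<in>Poly_Mapping.keys f. Poly_Mapping.single (h p) (Poly_Mapping.lookup f p))"

lemma push_forward_zero [simp]: "push_forward h 0 = 0"
  by (simp add: push_forward_def)

lemma push_forward_single [simp]:
  "push_forward h (Poly_Mapping.single p c) = Poly_Mapping.single (h p) c"
  by (simp add: push_forward_def)

lemma push_forward_add: "push_forward h (f + g) = push_forward h f + push_forward h g"
  unfolding push_forward_def by (rule setsum_keys_plus_distrib) (simp_all add: single_add)

lemma push_forward_sum: "push_forward h (\<Sum>i\<in>I. f i) = (\<Sum>i\<in>I. push_forward h (f i))"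
  by (induction I rule: infinite_finite_induct) (simp_all add: push_forward_add)

definition iso_path ::
  "('v, 'a, 'w, 'b) digraph_isomorphism \<Rightarrow> 'v \<times> 'a list \<Rightarrow> 'w \<times> 'b list" where
  "iso_path \<phi> p = (iso_verts \<phi> (fst p), map (iso_arcs \<phi>) (snd p))"

context wf_digraph
begin

lemma iso_path_in_quiver_paths:
  "digraph_isomorphism \<phi> \<Longrightarrow> p \<in> quiver_paths G \<Longrightarrow> iso_path \<phi> p \<in> quiver_paths (app_iso \<phi> G)"
  unfolding quiver_paths_def iso_path_def using awalk_app_isoI by fastforce

lemma path_end_iso_path:
  "digraph_isomorphism \<phi> \<Longrightarrow> p \<in> quiver_paths G \<Longrightarrow>
   path_end (app_iso \<phi> G) (iso_path \<phi> p) = iso_verts \<phi> (path_end G p)"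
  by (auto simp: quiver_paths_def iso_path_def path_end_def awalk_verts_app_iso_eq last_map)

lemma inv_iso_path:
  assumes "digraph_isomorphism \<phi>" "p \<in> quiver_paths G"
  shows "iso_path (inv_iso \<phi>) (iso_path \<phi> p) = p"
proof -
  obtain u w v where p: "p = (u, w)" "awalk u w v"
    using assms(2) by (auto simp: quiver_paths_def)
  have "map (iso_arcs (inv_iso \<phi>) \<circ> iso_arcs \<phi>) w = w"
    using p(2) assms(1) by (intro map_idI) (auto simp: awalk_def subset_iff)
  then show ?thesis
    using p assms(1) by (auto simp: iso_path_def)
qed

lemma push_forward_in_path_algebra:
  fixes f :: "('a \<times> 'b list) \<Rightarrow>\<^sub>0 'k::field"
  assumes "digraph_isomorphism \<phi>" "f \<in> carrier (path_algebra G)"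
  shows "push_forward (iso_path \<phi>) f \<in> carrier (path_algebra (app_iso \<phi> G))"
  using assms(2) unfolding push_forward_def
  by (intro sum_in_path_algebra single_in_path_algebra iso_path_in_quiver_paths[OF assms(1)])
     (auto simp: path_algebra_simps)

lemma push_forward_inverse:
  fixes f :: "('a \<times> 'b list) \<Rightarrow>\<^sub>0 'k::field"
  assumes "digraph_isomorphism \<phi>" "f \<in> carrier (path_algebra G)"
  shows "push_forward (iso_path (inv_iso \<phi>)) (push_forward (iso_path \<phi>) f) = f"
  using assms(2)
  by (induction f rule: path_algebra_induct) (simp_all add: push_forward_add inv_iso_path assms(1))

lemma push_forward_path_product:
  assumes iso: "digraph_isomorphism \<phi>" and p: "p \<in> quiver_paths G" and q: "q \<in> quiver_paths G"
  shows "push_forward (iso_path \<phi>) (path_product G p q c) =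
         path_product (app_iso \<phi> G) (iso_path \<phi> p) (iso_path \<phi> q) c"
proof -
  have "path_end G p \<in> verts G" "fst q \<in> verts G"
    using p q by (auto simp: path_end_in_verts quiver_paths_def)
  then have "path_end (app_iso \<phi> G) (iso_path \<phi> p) = fst (iso_path \<phi> q) \<longleftrightarrow> path_end G p = fst q"
    using iso p by (simp add: path_end_iso_path) (simp add: iso_path_def)
  then show ?thesis
    by (simp add: path_product_def) (simp add: iso_path_def)
qed

lemma push_forward_mult:
  fixes f g :: "('a \<times> 'b list) \<Rightarrow>\<^sub>0 'k::field"
  assumes iso: "digraph_isomorphism \<phi>"
    and f: "f \<in> carrier (path_algebra G)" and g: "g \<in> carrier (path_algebra G)"
  shows "push_forward (iso_path \<phi>) (f \<otimes>\<^bsub>path_algebra G\<^esub> g) =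
         push_forward (iso_path \<phi>) f \<otimes>\<^bsub>path_algebra (app_iso \<phi> G)\<^esub> push_forward (iso_path \<phi>) g"
  using f
proof (induction f rule: path_algebra_induct)
  case (single p a)
  note p = this
  show ?case
    using g
  proof (induction g rule: path_algebra_induct)
    case (single q b)
    then show ?case
      using p by (simp add: path_mult_single push_forward_path_product[OF iso])
  qed (simp_all add: path_mult_add_right push_forward_add)
qed (simp_all add: path_mult_add_left push_forward_add)

text \<open>
  The inverse is the linear extension of the path map of the inverse isomorphism of quivers.
\<close>

theorem push_forward_alg_iso:
  assumes iso: "digraph_isomorphism \<phi>"
  shows "push_forward (iso_path \<phi>) \<in>
         alg_iso (path_algebra G :: ('k::field, ('a \<times> 'b list) \<Rightarrow>\<^sub>0 'k) module) (path_algebra (app_iso \<phi> G))"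
proof -
  let ?A = "path_algebra G :: ('k, ('a \<times> 'b list) \<Rightarrow>\<^sub>0 'k) module"
  let ?B = "path_algebra (app_iso \<phi> G) :: ('k, _) module"
  let ?\<Phi> = "push_forward (iso_path \<phi>) :: (_ \<Rightarrow>\<^sub>0 'k) \<Rightarrow> _"
  let ?\<Psi> = "push_forward (iso_path (inv_iso \<phi>)) :: (_ \<Rightarrow>\<^sub>0 'k) \<Rightarrow> _"
  interpret H: wf_digraph "app_iso \<phi> G"
    using iso by (rule wf_digraphI_app_iso)
  note inv = digraph_isomorphism_invI[OF iso]
  have cancel: "iso_path \<phi> (iso_path (inv_iso \<phi>) p) = p" if "p \<in> quiver_paths (app_iso \<phi> G)" for p
  proof -
    obtain u w v where p: "p = (u, w)" "H.awalk u w v"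
      using \<open>p \<in> _\<close> by (auto simp: quiver_paths_def)
    then have "u \<in> verts (app_iso \<phi> G)" "set w \<subseteq> arcs (app_iso \<phi> G)"
      by (simp_all only: H.awalk_def)
    then have "map (iso_arcs \<phi> \<circ> iso_arcs (inv_iso \<phi>)) w = w"
        "iso_verts \<phi> (iso_verts (inv_iso \<phi>) u) = u"
      using iso by (auto intro!: map_idI simp: subset_iff)
    then show ?thesis
      by (simp add: p iso_path_def)
  qed
  have "?\<Phi> (?\<Psi> f) = f" if "f \<in> carrier ?B" for f
    using that by (induction f rule: path_algebra_induct) (simp_all add: push_forward_add cancel)
  moreover have "?\<Psi> f \<in> carrier ?A" if "f \<in> carrier ?B" for f
    using H.push_forward_in_path_algebra[OF inv that] iso by simp
  ultimately have "bij_betw ?\<Phi> (carrier ?A) (carrier ?B)"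
    using push_forward_in_path_algebra[OF iso] push_forward_inverse[OF iso]
    by (intro bij_betw_byWitness[where f' = ?\<Psi>]) auto
  moreover have "?\<Phi> \<in> ring_hom ?A ?B"
  proof (rule ring_hom_memI)
    have "inj_on (iso_verts \<phi>) (verts G)"
      using iso by (rule digraph_isomorphism_inj_on_verts)
    then show "?\<Phi> \<one>\<^bsub>?A\<^esub> = \<one>\<^bsub>?B\<^esub>"
      by (simp add: path_algebra_simps push_forward_sum iso_path_def sum.reindex)
  qed (simp_all add: push_forward_in_path_algebra[OF iso] push_forward_mult[OF iso]
      path_algebra_simps(4) push_forward_add)
  moreover have "?\<Phi> (c \<odot>\<^bsub>?A\<^esub> f) = c \<odot>\<^bsub>?B\<^esub> ?\<Phi> f" if "f \<in> carrier ?A" for c f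
    using that unfolding path_algebra_simps(5)
    by (induction f rule: path_algebra_induct)
       (simp_all add: map_times_zero map_times_single map_times_add push_forward_add)
  ultimately show ?thesis
    by (simp add: alg_iso_def ring_iso_def)
qed

end

section \<open>Quotients of algebras by generated ideals\<close>

lemma ring_hom_image_genideal_subset:
  assumes "ring A" "ring B" and h: "h \<in> ring_hom A B" and S: "S \<subseteq> carrier A"
  shows "h ` genideal A S \<subseteq> genideal B (h ` S)"
proof -
  interpret ring_hom_ring A B h
    using assms by (simp add: ring_hom_ringI2)
  have hS: "h ` S \<subseteq> carrier B"
    using S by auto
  have "S \<subseteq> {r \<in> carrier A. h r \<in> genideal B (h ` S)}"
    using S S.genideal_self[OF hS] by auto
  then have "genideal A S \<subseteq> {r \<in> carrier A. h r \<in> genideal B (h ` S)}"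
    by (intro R.genideal_minimal ideal_vimage S.genideal_ideal hS)
  then show ?thesis
    by auto
qed

text \<open>
  Preimages of ideals are ideals, which gives one inclusion for every homomorphism; the other one is
  the same inclusion for the inverse isomorphism.
\<close>

lemma ring_iso_image_genideal:
  assumes A: "ring A" and B: "ring B" and h: "h \<in> ring_iso A B" and S: "S \<subseteq> carrier A"
  shows "h ` genideal A S = genideal B (h ` S)"
proof (rule antisym)
  let ?g = "inv_into (carrier A) h"
  have hom: "h \<in> ring_hom A B" and bij: "bij_betw h (carrier A) (carrier B)"
    using h by (auto simp: ring_iso_def)
  have g: "?g \<in> ring_hom B A"
    using ring_iso_set_sym[OF A h] by (simp add: ring_iso_def)
  have hS: "h ` S \<subseteq> carrier B"
    using S bij by (auto simp: bij_betw_def)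
  show "h ` genideal A S \<subseteq> genideal B (h ` S)"
    by (rule ring_hom_image_genideal_subset[OF A B hom S])
  have "?g ` h ` S = S"
    using S bij by (simp add: bij_betw_def inv_into_image_cancel)
  then have "?g ` genideal B (h ` S) \<subseteq> genideal A S"
    using ring_hom_image_genideal_subset[OF B A g hS] by simp
  then have "h ` ?g ` genideal B (h ` S) \<subseteq> h ` genideal A S"
    by (rule image_mono)
  moreover have "genideal B (h ` S) \<subseteq> h ` carrier A"
    using ideal.Icarr[OF ring.genideal_ideal[OF B hS]] bij by (auto simp: bij_betw_def)
  ultimately show "genideal B (h ` S) \<subseteq> h ` genideal A S"
    by (simp add: image_inv_into_cancel[OF refl])
qed

lemma quot_algebra_simps:
  "carrier (quot_algebra A I) = a_rcosets\<^bsub>A\<^esub> I"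
  "X \<otimes>\<^bsub>quot_algebra A I\<^esub> Y = rcoset_mult A I X Y"
  "X \<oplus>\<^bsub>quot_algebra A I\<^esub> Y = X <+>\<^bsub>A\<^esub> Y"
  "\<one>\<^bsub>quot_algebra A I\<^esub> = I +>\<^bsub>A\<^esub> \<one>\<^bsub>A\<^esub>"
  "c \<odot>\<^bsub>quot_algebra A I\<^esub> X = (\<Union>x\<in>X. I +>\<^bsub>A\<^esub> (c \<odot>\<^bsub>A\<^esub> x))"
  by (simp_all add: quot_algebra_def FactRing_def ring.defs module.defs)

text \<open>
  The isomorphism sends a coset to its image, which is a coset of the image ideal; all operations on
  cosets are computed on representatives.
\<close>

lemma alg_iso_quot_algebra:
  assumes A: "ring A" and B: "ring B"
    and smult: "\<And>c x. x \<in> carrier A \<Longrightarrow> c \<odot>\<^bsub>A\<^esub> x \<in> carrier A"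
    and h: "h \<in> alg_iso A B" and I: "ideal I A" and J: "ideal (h ` I) B"
  shows "(`) h \<in> alg_iso (quot_algebra A I) (quot_algebra B (h ` I))"
proof -
  have iso: "h \<in> ring_iso A B" and h_smult: "\<And>c x. x \<in> carrier A \<Longrightarrow> h (c \<odot>\<^bsub>A\<^esub> x) = c \<odot>\<^bsub>B\<^esub> h x"
    using h by (auto simp: alg_iso_def)
  interpret A: ring A by (rule A)
  interpret B: ring B by (rule B)
  interpret I: ideal I A by (rule I)
  interpret J: ideal "h ` I" B by (rule J)
  interpret h: ring_hom_ring A B h
    using A B iso by (simp add: ring_hom_ringI2 ring_iso_def)
  have inj: "inj_on h (carrier A)" and surj: "h ` carrier A = carrier B"
    using iso by (auto simp: ring_iso_def bij_betw_def)
  have coset: "h ` (I +>\<^bsub>A\<^esub> x) = h ` I +>\<^bsub>B\<^esub> h x" if "x \<in> carrier A" for x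
    using that I.Icarr by (auto simp: a_r_coset_def' image_image image_UN)
  have coset_subset: "I +>\<^bsub>A\<^esub> x \<subseteq> carrier A" if "x \<in> carrier A" for x
    using that I.Icarr by (auto simp: a_r_coset_def')
  have "bij_betw ((`) h) (a_rcosets\<^bsub>A\<^esub> I) (a_rcosets\<^bsub>B\<^esub> (h ` I))"
  proof (rule bij_betw_imageI)
    show "inj_on ((`) h) (a_rcosets\<^bsub>A\<^esub> I)"
      using coset_subset
      by (intro inj_on_subset[OF inj_on_image_Pow[OF inj]]) (auto simp: A_RCOSETS_def')
    show "(`) h ` (a_rcosets\<^bsub>A\<^esub> I) = a_rcosets\<^bsub>B\<^esub> (h ` I)"
    proof -
      have "(`) h ` (a_rcosets\<^bsub>A\<^esub> I) = (\<Union>x\<in>carrier A. {h ` I +>\<^bsub>B\<^esub> h x})"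
        by (auto simp: A_RCOSETS_def' image_UN coset)
      also have "\<dots> = (\<Union>y\<in>h ` carrier A. {h ` I +>\<^bsub>B\<^esub> y})"
        by blast
      finally show ?thesis
        by (simp add: A_RCOSETS_def' surj)
    qed
  qed
  moreover have "(`) h \<in> ring_hom (quot_algebra A I) (quot_algebra B (h ` I))"
  proof (rule ring_hom_memI)
    fix X Y
    assume "X \<in> carrier (quot_algebra A I)" "Y \<in> carrier (quot_algebra A I)"
    then obtain x y where X: "X = I +>\<^bsub>A\<^esub> x" "x \<in> carrier A" and Y: "Y = I +>\<^bsub>A\<^esub> y" "y \<in> carrier A"
      by (auto simp: quot_algebra_simps A_RCOSETS_def')
    show "h ` X \<in> carrier (quot_algebra B (h ` I))"
      using X by (simp add: quot_algebra_simps coset) (auto simp: A_RCOSETS_def')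
    show "h ` (X \<otimes>\<^bsub>quot_algebra A I\<^esub> Y) = h ` X \<otimes>\<^bsub>quot_algebra B (h ` I)\<^esub> h ` Y"
      using X Y by (simp add: quot_algebra_simps coset I.rcoset_mult_add J.rcoset_mult_add)
    show "h ` (X \<oplus>\<^bsub>quot_algebra A I\<^esub> Y) = h ` X \<oplus>\<^bsub>quot_algebra B (h ` I)\<^esub> h ` Y"
      using X Y by (simp add: quot_algebra_simps coset I.a_rcos_sum J.a_rcos_sum)
  qed (simp add: quot_algebra_simps coset)
  moreover have "h ` (c \<odot>\<^bsub>quot_algebra A I\<^esub> X) = c \<odot>\<^bsub>quot_algebra B (h ` I)\<^esub> h ` X"
    if "X \<in> carrier (quot_algebra A I)" for c X
  proof -
    have "X \<subseteq> carrier A"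
      using that coset_subset by (auto simp: quot_algebra_simps A_RCOSETS_def')
    then show ?thesis
      by (auto simp: quot_algebra_simps image_UN coset smult h_smult subset_iff intro!: SUP_cong)
  qed
  ultimately show ?thesis
    by (simp add: alg_iso_def ring_iso_def quot_algebra_simps(1))
qed

text \<open>
  The generators of the ideal in \<open>bound_quiver_algebra G R\<close>.
\<close>

definition relators :: "('v, 'a) pre_digraph \<Rightarrow> 'a list set \<Rightarrow> (('v \<times> 'a list) \<Rightarrow>\<^sub>0 'k::field) set" where
  "relators G R = (\<lambda>w. Poly_Mapping.single (arcs_path G w) 1) ` R"

context fin_digraph
begin

lemma arcs_path_in_quiver_paths:
  assumes "awalk u w v" "w \<noteq> []"
  shows "arcs_path G w = (u, w)" "arcs_path G w \<in> quiver_paths G"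
proof -
  show "arcs_path G w = (u, w)"
    using assms by (cases w) (auto simp: arcs_path_def awalk_Cons_iff)
  then show "arcs_path G w \<in> quiver_paths G"
    using assms by (auto simp: quiver_paths_def)
qed

lemma relators_subset_carrier:
  assumes "\<And>w. w \<in> R \<Longrightarrow> w \<noteq> [] \<and> (\<exists>u v. awalk u w v)"
  shows "relators G R \<subseteq> carrier (path_algebra G)"
  using assms arcs_path_in_quiver_paths(2)
  by (auto simp: relators_def intro!: single_in_path_algebra)

text \<open>
  A path \<open>w = xs r ys\<close> is the product of the paths \<open>xs\<close>, \<open>r\<close> and \<open>ys\<close> in the path algebra.
\<close>

lemma ideal_single_sublist:
  assumes I: "ideal I (path_algebra G :: ('k::field, ('a \<times> 'b list) \<Rightarrow>\<^sub>0 'k) module)"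
    and r: "Poly_Mapping.single (arcs_path G r) 1 \<in> I" "r \<noteq> []"
    and w: "awalk u w v" "sublist r w"
  shows "Poly_Mapping.single (arcs_path G w) 1 \<in> I"
proof -
  interpret ideal I "path_algebra G :: ('k, ('a \<times> 'b list) \<Rightarrow>\<^sub>0 'k) module"
    by (rule I)
  obtain xs ys where w_eq: "w = xs @ r @ ys"
    using w(2) by (auto simp: sublist_def)
  let ?a = "awlast u xs"
  let ?b = "awlast ?a r"
  have xs: "awalk u xs ?a" and r': "awalk ?a r ?b" and ys: "awalk ?b ys v"
    using w(1) unfolding w_eq awalk_append_iff by blast+
  have "(u, xs) \<in> quiver_paths G" "(?b, ys) \<in> quiver_paths G"
    using xs ys by (auto simp: quiver_paths_def)
  then have "Poly_Mapping.single (u, xs) 1 \<otimes>\<^bsub>path_algebra G\<^esub>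
      (Poly_Mapping.single (arcs_path G r) 1 \<otimes>\<^bsub>path_algebra G\<^esub> Poly_Mapping.single (?b, ys) 1) \<in> I"
    by (intro I_l_closed I_r_closed r(1) single_in_path_algebra)
  moreover have "w \<noteq> []"
    using r(2) w_eq by simp
  ultimately show ?thesis
    using arcs_path_in_quiver_paths(1)[OF r' r(2)] arcs_path_in_quiver_paths(1)[OF w(1)]
    by (simp add: path_mult_single path_product_def path_end_def w_eq)
qed

text \<open>
  An ideal containing \<open>R\<close> contains all paths through an element of \<open>R\<close>, so adding such paths to the
  generators does not enlarge the ideal.
\<close>

lemma genideal_relators_sublist_closure:
  assumes R: "\<And>r. r \<in> R \<Longrightarrow> r \<noteq> []" "R \<subseteq> R'"
    and R': "\<And>w. w \<in> R' \<Longrightarrow> (\<exists>u v. awalk u w v) \<and> (\<exists>r\<in>R. sublist r w)"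
  shows "genideal (path_algebra G :: ('k::field, ('a \<times> 'b list) \<Rightarrow>\<^sub>0 'k) module) (relators G R') =
         genideal (path_algebra G) (relators G R)"
proof -
  have "relators G R' \<subseteq> I \<longleftrightarrow> relators G R \<subseteq> I"
    if I: "ideal I (path_algebra G :: ('k, ('a \<times> 'b list) \<Rightarrow>\<^sub>0 'k) module)" for I
  proof
    assume "relators G R \<subseteq> I"
    then have gen: "Poly_Mapping.single (arcs_path G r) 1 \<in> I" if "r \<in> R" for r
      using that by (auto simp: relators_def)
    have "Poly_Mapping.single (arcs_path G w) 1 \<in> I" if "w \<in> R'" for w
      using R'[OF that] ideal_single_sublist[OF I gen R(1)] by blast
    then show "relators G R' \<subseteq> I"
      by (auto simp: relators_def)
  qed (use R(2) in \<open>auto simp: relators_def\<close>)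
  then have "{I. ideal I (path_algebra G :: ('k, ('a \<times> 'b list) \<Rightarrow>\<^sub>0 'k) module) \<and> relators G R' \<subseteq> I} =
      {I. ideal I (path_algebra G) \<and> relators G R \<subseteq> I}"
    by (simp cong: conj_cong)
  then show ?thesis
    by (simp only: genideal_def)
qed

theorem bound_quiver_algebra_app_iso:
  assumes iso: "digraph_isomorphism \<phi>"
    and R: "\<And>w. w \<in> R \<Longrightarrow> w \<noteq> [] \<and> (\<exists>u v. awalk u w v)"
  shows "(bound_quiver_algebra G R :: ('k::field, (('a \<times> 'b list) \<Rightarrow>\<^sub>0 'k) set) module) \<cong>\<^sub>a\<^sub>l\<^sub>g
         bound_quiver_algebra (app_iso \<phi> G) (map (iso_arcs \<phi>) ` R)"
proof -
  let ?A = "path_algebra G :: ('k, ('a \<times> 'b list) \<Rightarrow>\<^sub>0 'k) module"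
  let ?B = "path_algebra (app_iso \<phi> G) :: ('k, _) module"
  let ?h = "push_forward (iso_path \<phi>) :: (_ \<Rightarrow>\<^sub>0 'k) \<Rightarrow> _"
  interpret H: fin_digraph "app_iso \<phi> G"
    using iso by (rule fin_digraphI_app_iso)
  note rings = ring_path_algebra H.ring_path_algebra
  have h: "?h \<in> alg_iso ?A ?B"
    by (rule push_forward_alg_iso[OF iso])
  then have h': "?h \<in> ring_iso ?A ?B"
    by (simp add: alg_iso_def)
  have "iso_path \<phi> (arcs_path G w) = arcs_path (app_iso \<phi> G) (map (iso_arcs \<phi>) w)" if "w \<in> R" for w
    using R[OF that] iso
    by (cases w) (auto simp: arcs_path_def iso_path_def iso_verts_tail awalk_Cons_iff)
  then have "?h ` relators G R = relators (app_iso \<phi> G) (map (iso_arcs \<phi>) ` R)"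
    by (simp add: relators_def image_image)
  moreover have sub: "relators G R \<subseteq> carrier ?A"
    using R by (rule relators_subset_carrier)
  ultimately have image: "?h ` genideal ?A (relators G R) =
      genideal ?B (relators (app_iso \<phi> G) (map (iso_arcs \<phi>) ` R))"
    using ring_iso_image_genideal[OF rings h' sub] by simp
  have "relators (app_iso \<phi> G) (map (iso_arcs \<phi>) ` R) \<subseteq> carrier ?B"
    using R awalk_app_isoI[OF _ iso] by (intro H.relators_subset_carrier) blast
  then have "ideal (?h ` genideal ?A (relators G R)) ?B"
    unfolding image by (intro ring.genideal_ideal rings)
  then have "(`) ?h \<in> alg_iso (quot_algebra ?A (genideal ?A (relators G R)))
      (quot_algebra ?B (?h ` genideal ?A (relators G R)))"
    by (intro alg_iso_quot_algebra rings h smult_in_path_algebra ring.genideal_ideal sub)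
  then show ?thesis
    unfolding image by (auto simp: alg_isomorphic_def bound_quiver_algebra_def relators_def)
qed

end

section \<open>Strings of direct syllables and the states of the automaton\<close>

context signed_string_algebra
begin

text \<open>
  The permitted paths of positive length are the strings all of whose syllables are direct (lemma
  \<open>is_string_word_map_Dir\<close>).
\<close>

definition permitted :: "'a list \<Rightarrow> bool" where
  "permitted p \<longleftrightarrow> (\<exists>u v. awalk u p v) \<and> (\<forall>r\<in>\<rho>. \<not> sublist r p)"

lemma ex_awalk_iff:
  "p \<noteq> [] \<Longrightarrow> (\<exists>u v. awalk u p v) \<longleftrightarrow>
     set p \<subseteq> arcs Q \<and> successively (\<lambda>a b. head Q a = tail Q b) p"
proof (induction p)
  case (Cons a p)
  show ?case
  proof (cases p)
    case Nil
    then show ?thesis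
      by (auto simp: awalk_simps)
  next
    case p: (Cons b q)
    have "(\<exists>u v. awalk u (a # p) v) \<longleftrightarrow> a \<in> arcs Q \<and> head Q a = tail Q b \<and> (\<exists>u v. awalk u p v)"
      unfolding p awalk_Cons_iff by metis
    then show ?thesis
      using Cons.IH p by auto
  qed
qed simp

lemma ex_awalk_sublist:
  assumes "\<exists>u v. awalk u p v" "sublist q p"
  shows "\<exists>u v. awalk u q v"
proof -
  obtain u v xs ys where "awalk u (xs @ q @ ys) v"
    using assms unfolding sublist_def by blast
  then show ?thesis
    unfolding awalk_append_iff by blast
qed

lemma permitted_sublist: "permitted p \<Longrightarrow> sublist q p \<Longrightarrow> permitted q"
  unfolding permitted_def using ex_awalk_sublist sublist_order.order_trans by blast

lemma permitted_arc: "\<alpha> \<in> arcs Q \<Longrightarrow> permitted [\<alpha>]"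
  using rel_length by (fastforce simp: permitted_def awalk_Cons_iff awalk_Nil_iff dest: sublist_length_le)

lemma permitted_set: "permitted p \<Longrightarrow> set p \<subseteq> arcs Q"
  by (auto simp: permitted_def)

lemma permitted_consecutive:
  assumes "permitted p" "Suc i < length p"
  shows "head Q (p ! i) = tail Q (p ! Suc i)" "[p ! i, p ! Suc i] \<notin> \<rho>"
proof -
  have "p = take i p @ [p ! i, p ! Suc i] @ drop (Suc (Suc i)) p"
    using assms(2) by (simp add: Cons_nth_drop_Suc)
  then have "sublist [p ! i, p ! Suc i] p"
    unfolding sublist_def by blast
  then have "permitted [p ! i, p ! Suc i]"
    using assms(1) permitted_sublist by blast
  then show "head Q (p ! i) = tail Q (p ! Suc i)" "[p ! i, p ! Suc i] \<notin> \<rho>"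
    by (auto simp: permitted_def awalk_Cons_iff)
qed

lemma permitted_snoc:
  assumes "permitted (p @ [\<beta>])" "p \<noteq> []"
  shows "\<beta> \<in> arcs Q" "head Q (last p) = tail Q \<beta>" "[last p, \<beta>] \<notin> \<rho>"
proof -
  have "p @ [\<beta>] = butlast p @ [last p, \<beta>]"
    using assms(2) by simp
  then have "permitted [last p, \<beta>]"
    using assms(1) permitted_sublist by (metis sublist_append_leftI)
  then show "\<beta> \<in> arcs Q" "head Q (last p) = tail Q \<beta>" "[last p, \<beta>] \<notin> \<rho>"
    by (auto simp: permitted_def awalk_Cons_iff)
qed

lemma map_Dir_eq_iff [simp]: "map Dir p = map Dir q \<longleftrightarrow> p = q"
  by (rule inj_map_eq_map) (simp add: inj_def)

lemma suffix_map_Dir_iff: "suffix s (map Dir p) \<longleftrightarrow> (\<exists>q. s = map Dir q \<and> suffix q p)"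
  by (auto simp: suffix_def map_eq_append_conv)

lemma sublist_map_iff: "sublist ys (map f xs) \<longleftrightarrow> (\<exists>zs. ys = map f zs \<and> sublist zs xs)"
  by (metis map_mono_sublist sublist_map_rightE)

lemma is_string_word_map_Dir:
  "is_string_word (map Dir p) \<longleftrightarrow> p \<noteq> [] \<and> permitted p"
proof (cases "p = []")
  case False
  have "map Dir q \<in> rel_words \<longleftrightarrow> q \<in> \<rho>" for q
    by (auto simp: rel_words_def)
  moreover have "word_inv (map Dir q) \<notin> rel_words" for q :: "'a list"
    using rel_length by (cases q rule: rev_cases) (fastforce simp: rel_words_def word_inv_def)+
  ultimately have "(\<forall>y. sublist y (map Dir p) \<longrightarrow> y \<notin> rel_words \<and> word_inv y \<notin> rel_words) \<longleftrightarrow>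
      (\<forall>r\<in>\<rho>. \<not> sublist r p)"
    by (auto simp: sublist_map_iff)
  moreover have "set (map Dir p) \<subseteq> syllables (arcs Q) \<longleftrightarrow> set p \<subseteq> arcs Q"
    by (auto simp: syllables_def)
  ultimately show ?thesis
    using False unfolding is_string_word_def permitted_def ex_awalk_iff[OF False]
    by (auto simp: successively_conv_nth)
qed (simp add: is_string_word_def)

lemma is_string_word_prefix:
  assumes "is_string_word (u @ s)" "u \<noteq> []"
  shows "is_string_word u"
  unfolding is_string_word_def
proof (intro conjI allI impI)
  show "u \<noteq> []"
    by (rule assms(2))
  show "set u \<subseteq> syllables (arcs Q)"
    using assms(1) by (simp add: is_string_word_def)
next
  fix i
  assume "Suc i < length u"
  then show "syl_target (u ! i) = syl_source (u ! Suc i)" "u ! i \<noteq> syl_inv (u ! Suc i)"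
    using assms(1) by (auto simp: is_string_word_def nth_append dest: spec[of _ i])
next
  fix y
  assume "sublist y u"
  then have "sublist y (u @ s)"
    by (simp add: sublist_append)
  then show "y \<notin> rel_words" "word_inv y \<notin> rel_words"
    using assms(1) by (auto simp: is_string_word_def)
qed

lemma is_string_word_syllable:
  assumes "b \<in> syllables (arcs Q)"
  shows "is_string_word [b]"
proof -
  have "y \<notin> rel_words \<and> word_inv y \<notin> rel_words" if "sublist y [b]" for y
    using sublist_length_le[OF that] rel_length by (fastforce simp: rel_words_def word_inv_def
        dest: arg_cong[where f = length])
  then show ?thesis
    using assms by (simp add: is_string_word_def)
qed

lemma Word_in_strings: "Word w \<in> strings \<longleftrightarrow> is_string_word w"
  by (auto simp: strings_def zero_strings_def)

lemma string_states_is_string_word: "Word w \<in> string_states \<Longrightarrow> is_string_word w"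
  by (auto simp: string_states_def zero_strings_def Word_in_strings is_string_word_syllable)

lemma syllable_in_string_states: "b \<in> syllables (arcs Q) \<Longrightarrow> Word [b] \<in> string_states"
  by (auto simp: string_states_def)

text \<open>
  A state with at least two syllables is a proper prefix of a relation or of an inverse of one, and
  these prefixes are closed under dropping the last syllable. This allows the longest state suffix to
  be computed syllable by syllable.
\<close>

lemma string_states_butlast:
  assumes "Word (w @ [b]) \<in> string_states" "w \<noteq> []"
  shows "Word w \<in> string_states"
proof -
  obtain r where "r \<in> rel_words \<or> word_inv r \<in> rel_words" "strict_prefix (w @ [b]) r"
    using assms by (auto simp: string_states_def zero_strings_def)
  moreover from this have "strict_prefix w r"
    by (auto simp: strict_prefix_def prefix_def)
  moreover have "Word w \<in> strings"
    using string_states_is_string_word[OF assms(1)] is_string_word_prefix[OF _ assms(2)]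
    by (auto simp: Word_in_strings)
  ultimately show ?thesis
    by (auto simp: string_states_def)
qed

lemma relation_prefix_in_string_states:
  assumes "q @ [\<beta>] \<in> \<rho>" "permitted q" "q \<noteq> []"
  shows "Word (map Dir q) \<in> string_states"
proof -
  have "map Dir (q @ [\<beta>]) \<in> rel_words"
    using assms(1) unfolding rel_words_def by (rule imageI)
  moreover have "strict_prefix (map Dir q) (map Dir (q @ [\<beta>]))"
    by (simp add: strict_prefix_def)
  ultimately have "\<exists>r. (r \<in> rel_words \<or> word_inv r \<in> rel_words) \<and> strict_prefix (map Dir q) r"
    by blast
  then show ?thesis
    using assms(2,3) by (auto simp: string_states_def Word_in_strings is_string_word_map_Dir)
qed

text \<open>
  The invariant of a run: \<open>s\<close> is the state reached after reading the word \<open>w\<close>.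
\<close>

definition longest_state_suffix :: "'a syllable list \<Rightarrow> 'a syllable list \<Rightarrow> bool" where
  "longest_state_suffix w s \<longleftrightarrow> suffix s w \<and> Word s \<in> string_states \<and>
     (\<forall>s'. suffix s' w \<and> Word s' \<in> string_states \<longrightarrow> suffix s' s)"

lemma right_substring_suffix:
  assumes "is_string_word w" "suffix s w" "Word s \<in> string_states"
  shows "right_substring (Word s) (Word w)"
proof -
  obtain u where u: "w = u @ s"
    using assms(2) by (auto simp: suffix_def)
  have s: "is_string_word s"
    using assms(3) by (rule string_states_is_string_word)
  show ?thesis
  proof (cases "u = []")
    case True
    let ?u = "Triv (str_source (Word s)) (- str_sigma (Word s))"
    have "hd s \<in> syllables (arcs Q)"
      using s by (auto simp: is_string_word_def)
    then have "?u \<in> strings"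
      using sigma_sign eps_sign by (fastforce simp: strings_def zero_strings_def syllables_def)
    moreover have "str_conc ?u (Word s) = Some (Word w)"
      by (simp add: u True)
    ultimately show ?thesis
      using s unfolding right_substring_def Word_in_strings by blast
  next
    case False
    then show ?thesis
      using assms(1) s is_string_word_prefix[of u s]
      by (auto simp: right_substring_def Word_in_strings u intro!: bexI[of _ "Word u"])
  qed
qed

lemma right_substringD:
  assumes "right_substring y (Word w)"
  shows "str_length y = 0 \<or> (\<exists>s. y = Word s \<and> suffix s w)"
proof -
  obtain u where "str_conc u y = Some (Word w)"
    using assms by (auto simp: right_substring_def)
  then show ?thesis
    by (cases u; cases y) (auto simp: suffix_def split: if_splits)
qed

text \<open>
  The maximum in the transition function is attained at a nonempty word, because the last syllable is
  always a candidate, whereas the zero-length strings have length \<open>0\<close>. Two suffixes of the same word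
  are comparable, so a state suffix of maximal length has all the others as suffixes.
\<close>

lemma arg_max_right_substring:
  assumes w: "is_string_word w"
  obtains s where
    "(ARG_MAX str_length y. y \<in> string_states \<and> right_substring y (Word w)) = Word s"
    "longest_state_suffix w s"
proof -
  let ?P = "\<lambda>y. y \<in> string_states \<and> right_substring y (Word w)"
  let ?m = "ARG_MAX str_length y. ?P y"
  have bound: "\<forall>y. ?P y \<longrightarrow> str_length y < Suc (length w)"
    using right_substringD by (fastforce dest: suffix_length_le)
  have candidate: "?P (Word s)" if "suffix s w" "Word s \<in> string_states" for s
    using that right_substring_suffix[OF w] by blast
  have "suffix [last w] w" "last w \<in> syllables (arcs Q)"
    using w by (auto simp: is_string_word_def suffix_def intro: exI[of _ "butlast w"])
  then have last: "?P (Word [last w])"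
    by (intro candidate syllable_in_string_states)
  have max: "?P ?m" "?P y \<Longrightarrow> str_length y \<le> str_length ?m" for y
    using arg_max_nat_lemma[OF last bound] by auto
  then obtain s where s: "?m = Word s" "suffix s w"
    using right_substringD[of ?m w] max(2)[OF last] by auto
  have "suffix s' s" if "suffix s' w" "Word s' \<in> string_states" for s'
    using max(2)[OF candidate[OF that]] that(1) s by (auto intro: suffix_length_suffix)
  then show thesis
    using that[OF s(1)] s max(1) by (simp add: longest_state_suffix_def)
qed

section \<open>Runs of the automaton follow permitted paths\<close>

lemma string_step_Triv:
  "step string_mia (Triv v i) (Dir \<beta>) \<noteq> None \<longleftrightarrow>
     v \<in> verts Q \<and> i \<in> {-1, 1} \<and> \<beta> \<in> arcs Q \<and> tail Q \<beta> = v \<and> \<sigma> \<beta> = - i"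
  by (auto simp: string_mia_def string_states_def zero_strings_def syllables_def)

lemma string_step_Triv_value:
  assumes "\<beta> \<in> arcs Q"
  shows "step string_mia (Triv (tail Q \<beta>) (- \<sigma> \<beta>)) (Dir \<beta>) = Some (Word [Dir \<beta>])"
    and "longest_state_suffix [Dir \<beta>] [Dir \<beta>]"
proof -
  have \<beta>: "Dir \<beta> \<in> syllables (arcs Q)"
    using assms by (auto simp: syllables_def)
  obtain s where s:
    "(ARG_MAX str_length y. y \<in> string_states \<and> right_substring y (Word [Dir \<beta>])) = Word s"
    "longest_state_suffix [Dir \<beta>] s"
    using arg_max_right_substring[OF is_string_word_syllable[OF \<beta>]] by blast
  moreover have "s = [Dir \<beta>]"
    using s(2) syllable_in_string_states[OF \<beta>]
    by (auto simp: longest_state_suffix_def suffix_order.eq_iff)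
  moreover have "Triv (tail Q \<beta>) (- \<sigma> \<beta>) \<in> string_states"
    using assms sigma_sign by (fastforce simp: string_states_def zero_strings_def)
  ultimately show "step string_mia (Triv (tail Q \<beta>) (- \<sigma> \<beta>)) (Dir \<beta>) = Some (Word [Dir \<beta>])"
    and "longest_state_suffix [Dir \<beta>] [Dir \<beta>]"
    using \<beta> by (simp_all add: string_mia_def)
qed

text \<open>
  If appending \<open>\<beta>\<close> to the permitted path \<open>p\<close> creates a subpath \<open>r \<in> \<rho>\<close>, then \<open>r\<close> ends with \<open>\<beta>\<close>, and
  the rest of \<open>r\<close> is a suffix of \<open>p\<close> and a state, hence a suffix of \<open>s\<close>. So the relation \<open>r\<close> is already
  visible in \<open>s\<close> followed by \<open>\<beta>\<close>, although \<open>s\<close> may be much shorter than \<open>p\<close>.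
\<close>

lemma string_step_Word:
  assumes p: "permitted p" "p \<noteq> []" and s: "longest_state_suffix (map Dir p) s"
  shows "step string_mia (Word s) (Dir \<beta>) \<noteq> None \<longleftrightarrow> permitted (p @ [\<beta>])"
proof
  assume "step string_mia (Word s) (Dir \<beta>) \<noteq> None"
  then have sb: "is_string_word (s @ [Dir \<beta>])"
    by (auto simp: string_mia_def split: if_splits)
  obtain q where q: "s = map Dir q" "suffix q p"
    using s unfolding longest_state_suffix_def suffix_map_Dir_iff by blast
  have "q \<noteq> []"
    using s string_states_is_string_word[of s] by (auto simp: longest_state_suffix_def q is_string_word_def)
  have qb: "permitted (q @ [\<beta>])"
    using sb is_string_word_map_Dir[of "q @ [\<beta>]"] by (simp add: q)
  have "last q = last p"
    using q(2) \<open>q \<noteq> []\<close> by (auto simp: suffix_def)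
  then have walk: "\<exists>u v. awalk u (p @ [\<beta>]) v"
    using permitted_snoc[OF qb \<open>q \<noteq> []\<close>] p
    by (auto simp: permitted_def ex_awalk_iff successively_append_iff simp del: awalk_append_iff)
  have "\<not> sublist r (p @ [\<beta>])" if "r \<in> \<rho>" for r
  proof
    assume "sublist r (p @ [\<beta>])"
    then have "suffix r (p @ [\<beta>])"
      using p(1) that by (auto simp: sublist_snoc permitted_def)
    then obtain r' where r': "r = r' @ [\<beta>]" "suffix r' p"
      using rel_length[OF \<open>r \<in> \<rho>\<close>] by (cases r rule: rev_cases) auto
    \<comment> \<open>The empty prefix of a relation would be a zero-length string rather than a word.\<close>
    moreover from this have "r' \<noteq> []"
      using rel_length[OF \<open>r \<in> \<rho>\<close>] by auto
    ultimately have "Word (map Dir r') \<in> string_states"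
      using \<open>r \<in> \<rho>\<close> permitted_sublist[OF p(1)] by (intro relation_prefix_in_string_states) auto
    then have "suffix (map Dir r') (map Dir q)"
      using s r'(2) by (auto simp: longest_state_suffix_def q map_mono_suffix)
    then have "suffix r' q"
      by (auto simp: suffix_map_Dir_iff)
    then have "sublist r (q @ [\<beta>])"
      by (simp add: r'(1) suffix_imp_sublist)
    then show False
      using qb that by (auto simp: permitted_def)
  qed
  then show "permitted (p @ [\<beta>])"
    using walk by (simp add: permitted_def)
next
  assume pb: "permitted (p @ [\<beta>])"
  obtain q where q: "s = map Dir q" "suffix q p"
    using s unfolding longest_state_suffix_def suffix_map_Dir_iff by blast
  then have "suffix (q @ [\<beta>]) (p @ [\<beta>])"
    by simp
  then have "is_string_word (map Dir (q @ [\<beta>]))"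
    using permitted_sublist[OF pb] unfolding is_string_word_map_Dir by blast
  moreover have "\<beta> \<in> arcs Q"
    using permitted_set[OF pb] by simp
  ultimately show "step string_mia (Word s) (Dir \<beta>) \<noteq> None"
    using s by (auto simp: string_mia_def longest_state_suffix_def q syllables_def)
qed

text \<open>
  The longest state suffix of \<open>p\<close> followed by \<open>\<beta>\<close> lies in \<open>s\<close> followed by \<open>\<beta>\<close>, because dropping \<open>\<beta>\<close>
  leaves a state suffix of \<open>p\<close>.
\<close>

lemma string_step_Word_value:
  assumes p: "permitted p" "p \<noteq> []" and s: "longest_state_suffix (map Dir p) s"
    and "permitted (p @ [\<beta>])"
  obtains s' where "step string_mia (Word s) (Dir \<beta>) = Some (Word s')"
    "longest_state_suffix (map Dir (p @ [\<beta>])) s'"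
proof -
  have "step string_mia (Word s) (Dir \<beta>) \<noteq> None"
    using string_step_Word[OF p s] assms(4) by blast
  then have sb: "is_string_word (s @ [Dir \<beta>])"
    and step_eq: "step string_mia (Word s) (Dir \<beta>) =
      Some (ARG_MAX str_length y. y \<in> string_states \<and> right_substring y (Word (s @ [Dir \<beta>])))"
    by (auto simp: string_mia_def split: if_splits)
  obtain s' where s': "step string_mia (Word s) (Dir \<beta>) = Some (Word s')"
    "longest_state_suffix (s @ [Dir \<beta>]) s'"
    using arg_max_right_substring[OF sb] step_eq by metis
  have "suffix (s @ [Dir \<beta>]) (map Dir (p @ [\<beta>]))"
    using s by (simp add: longest_state_suffix_def)
  moreover have "suffix t s'" if t: "suffix t (map Dir (p @ [\<beta>]))" "Word t \<in> string_states" for t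
  proof -
    have "t \<noteq> []"
      using string_states_is_string_word[OF t(2)] by (simp add: is_string_word_def)
    then obtain t' where t': "t = t' @ [Dir \<beta>]" "suffix t' (map Dir p)"
      using t(1) by (cases t rule: rev_cases) auto
    have "suffix t' s"
    proof (cases "t' = []")
      case False
      then show ?thesis
        using s t' t(2) string_states_butlast by (auto simp: longest_state_suffix_def)
    qed simp
    then show ?thesis
      using s'(2) t(2) by (simp add: longest_state_suffix_def t'(1))
  qed
  ultimately have "longest_state_suffix (map Dir (p @ [\<beta>])) s'"
    using s'(2) by (auto simp: longest_state_suffix_def intro: suffix_order.trans)
  then show thesis
    using that s'(1) by blast
qed

lemma map_syllable_delta: "map_syllable delta b = Dir 0 \<longleftrightarrow> (\<exists>\<beta>. b = Dir \<beta>)"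
  by (cases b) (auto simp: delta_def)

lemma delta_step_defined:
  "step delta_mia x (Dir 0) \<noteq> None \<Longrightarrow> \<exists>\<beta>. step string_mia x (Dir \<beta>) \<noteq> None"
  by (auto simp: delta_mia_def map_syllable_delta split: if_splits)

lemma delta_step_eq:
  assumes "step string_mia x (Dir \<beta>) \<noteq> None"
    and "\<And>\<gamma>. step string_mia x (Dir \<gamma>) \<noteq> None \<Longrightarrow> \<gamma> = \<beta>"
  shows "step delta_mia x (Dir 0) = step string_mia x (Dir \<beta>)"
proof -
  have "(THE b. map_syllable delta b = Dir 0 \<and> step string_mia x b \<noteq> None) = Dir \<beta>"
    using assms unfolding map_syllable_delta by blast
  moreover have "\<exists>b. map_syllable delta b = Dir 0 \<and> step string_mia x b \<noteq> None"
    using assms(1) unfolding map_syllable_delta by blast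
  ultimately show ?thesis
    by (simp add: delta_mia_def)
qed

lemma sigma_injective:
  assumes "\<beta> \<in> arcs Q" "\<gamma> \<in> arcs Q" "tail Q \<beta> = tail Q \<gamma>" "\<sigma> \<beta> = \<sigma> \<gamma>"
  shows "\<beta> = \<gamma>"
  using sigma_source[OF assms(1,2) _ assms(3)] sigma_sign[OF assms(1)] assms(4)
  by (cases "\<beta> = \<gamma>") auto

lemma delta_step_Triv:
  assumes "\<beta> \<in> arcs Q"
  shows "step delta_mia (Triv (tail Q \<beta>) (- \<sigma> \<beta>)) (Dir 0) = Some (Word [Dir \<beta>])"
proof -
  have "\<gamma> = \<beta>" if "step string_mia (Triv (tail Q \<beta>) (- \<sigma> \<beta>)) (Dir \<gamma>) \<noteq> None" for \<gamma>
    using that assms sigma_injective[of \<gamma> \<beta>] unfolding string_step_Triv by auto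
  then show ?thesis
    using delta_step_eq[of "Triv (tail Q \<beta>) (- \<sigma> \<beta>)" \<beta>] string_step_Triv_value(1)[OF assms] by simp
qed

text \<open>
  This is what makes the single letter \<open>0\<close> determine the arrow to be read.
\<close>

lemma permitted_extension_unique:
  assumes "permitted (p @ [\<beta>])" "permitted (p @ [\<gamma>])" "p \<noteq> []"
  shows "\<gamma> = \<beta>"
proof -
  have "last p \<in> arcs Q"
    using assms(3) permitted_set[OF assms(1)] by auto
  then show ?thesis
    using unique_right permitted_snoc[OF assms(1,3)] permitted_snoc[OF assms(2,3)]
    by (blast dest: Uniq_D)
qed

lemma delta_step_Word:
  assumes p: "permitted p" "p \<noteq> []" and s: "longest_state_suffix (map Dir p) s"
    and pb: "permitted (p @ [\<beta>])"
  obtains s' where "step delta_mia (Word s) (Dir 0) = Some (Word s')"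
    "longest_state_suffix (map Dir (p @ [\<beta>])) s'"
proof -
  have "step delta_mia (Word s) (Dir 0) = step string_mia (Word s) (Dir \<beta>)"
  proof (rule delta_step_eq)
    show "step string_mia (Word s) (Dir \<beta>) \<noteq> None"
      using pb unfolding string_step_Word[OF p s] .
    show "\<gamma> = \<beta>" if "step string_mia (Word s) (Dir \<gamma>) \<noteq> None" for \<gamma>
      using that permitted_extension_unique[OF pb _ p(2)] unfolding string_step_Word[OF p s] by blast
  qed
  then show thesis
    using string_step_Word_value[OF p s pb] that by metis
qed

lemma step_word_snoc: "step_word M x (w @ [b]) = Option.bind (step_word M x w) (\<lambda>z. step M z b)"
  by (simp add: step_word_def)

definition string_arrow :: "'a \<Rightarrow> ('v, 'a) strng \<times> ('v, 'a) strng" where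
  "string_arrow \<alpha> = (Triv (tail Q \<alpha>) (- \<sigma> \<alpha>), Triv (head Q \<alpha>) (\<epsilon> \<alpha>))"

abbreviation run :: "'a list \<Rightarrow> ('v, 'a) strng option" where
  "run p \<equiv> step_word delta_mia (fst (string_arrow (hd p))) (replicate (length p) (Dir 0))"

lemma run_snoc: "p \<noteq> [] \<Longrightarrow> run (p @ [\<beta>]) = Option.bind (run p) (\<lambda>z. step delta_mia z (Dir 0))"
  by (simp add: step_word_snoc[symmetric] replicate_append_same)

lemma run_permitted:
  assumes "permitted p" "p \<noteq> []"
  obtains s where "run p = Some (Word s)" "longest_state_suffix (map Dir p) s"
proof -
  have "\<exists>s. run p = Some (Word s) \<and> longest_state_suffix (map Dir p) s"
    using assms
  proof (induction p rule: rev_induct)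
    case (snoc \<beta> p)
    have \<beta>: "\<beta> \<in> arcs Q"
      using permitted_set[OF snoc.prems(1)] by simp
    show ?case
    proof (cases "p = []")
      case True
      then show ?thesis
        using delta_step_Triv[OF \<beta>] string_step_Triv_value(2)[OF \<beta>]
        by (simp add: step_word_def string_arrow_def)
    next
      case False
      then have p: "permitted p"
        using snoc.prems(1) permitted_sublist by blast
      then obtain s where s: "run p = Some (Word s)" "longest_state_suffix (map Dir p) s"
        using snoc.IH False by blast
      obtain s' where "step delta_mia (Word s) (Dir 0) = Some (Word s')"
        "longest_state_suffix (map Dir (p @ [\<beta>])) s'"
        using delta_step_Word[OF p False s(2) snoc.prems(1)] by blast
      then show ?thesis
        using run_snoc[OF False] s(1) by auto
    qed
  qed simp
  then show thesis
    using that by blast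
qed

text \<open>
  By induction, the run on all but the last arrow \<open>\<beta>\<close> ends in the longest state suffix of a permitted
  path. The last step reads some arrow \<open>\<gamma>\<close> that extends this path to a permitted one. Both \<open>\<beta>\<close> and \<open>\<gamma>\<close>
  start where the path ends and have the sign \<open>\<sigma>\<close> opposite to \<open>\<epsilon>\<close> of its last arrow, so they are
  equal.
\<close>

lemma permitted_if_run:
  assumes "\<exists>u v. awalk u p v" "p \<noteq> []" "run p \<noteq> None"
    and "successively (\<lambda>\<alpha> \<beta>. \<epsilon> \<alpha> = - \<sigma> \<beta>) p"
  shows "permitted p"
  using assms
proof (induction p rule: rev_induct)
  case (snoc \<beta> p)
  have walk: "set (p @ [\<beta>]) \<subseteq> arcs Q" "successively (\<lambda>a b. head Q a = tail Q b) (p @ [\<beta>])"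
    using snoc.prems(1) ex_awalk_iff[of "p @ [\<beta>]"] by auto
  show ?case
  proof (cases "p = []")
    case True
    then show ?thesis
      using walk by (simp add: permitted_arc)
  next
    case False
    have "run p \<noteq> None"
      using snoc.prems(3) unfolding run_snoc[OF False] by (metis Option.bind.simps(1))
    moreover have "successively (\<lambda>\<alpha> \<beta>. \<epsilon> \<alpha> = - \<sigma> \<beta>) p" and last: "\<epsilon> (last p) = - \<sigma> \<beta>"
      using snoc.prems(4) False by (auto simp: successively_append_iff)
    moreover have "\<exists>u v. awalk u p v"
      using ex_awalk_sublist[OF snoc.prems(1)] by blast
    ultimately have p: "permitted p"
      using snoc.IH False by blast
    obtain s where s: "run p = Some (Word s)" "longest_state_suffix (map Dir p) s"
      using run_permitted[OF p False] .
    have "step delta_mia (Word s) (Dir 0) \<noteq> None"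
      using snoc.prems(3) unfolding run_snoc[OF False] s(1) by simp
    then obtain \<gamma> where \<gamma>: "permitted (p @ [\<gamma>])"
      using delta_step_defined string_step_Word[OF p False s(2)] by blast
    note \<gamma>' = permitted_snoc[OF \<gamma> False]
    have last_arc: "last p \<in> arcs Q"
      using walk(1) False by auto
    have "\<epsilon> (last p) = - \<sigma> \<gamma>"
      by (rule eps_sigma[OF last_arc \<gamma>'])
    moreover have "head Q (last p) = tail Q \<beta>"
      using walk(2) False by (auto simp: successively_append_iff)
    ultimately have "\<beta> = \<gamma>"
      using last \<gamma>' walk(1) by (intro sigma_injective) auto
    then show ?thesis
      using \<gamma> by simp
  qed
qed simp

section \<open>The quiver and the relations of the automaton\<close>

definition vertex_class :: "'v \<Rightarrow> ('v, 'a) strng set" where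
  "vertex_class v = {Triv v 1, Triv v (- 1)}"

lemma delta_mia_simps:
  "initials delta_mia = zero_strings"
  "opp delta_mia = str_inv"
  "entry delta_mia x = Triv (str_target x) (str_eps x)"
  by (simp_all add: delta_mia_def string_mia_def)

lemma mia_equiv_delta_mia:
  "mia_equiv delta_mia = {(x, y). x \<in> zero_strings \<and> (y = x \<or> y = str_inv x)}" (is "_ = ?E")
proof (rule antisym)
  have "equiv zero_strings ?E"
    by (rule equivI) (auto simp: zero_strings_def refl_on_def sym_def trans_def)
  then show "mia_equiv delta_mia \<subseteq> ?E"
    by (auto simp: mia_equiv_def delta_mia_simps)
  show "?E \<subseteq> mia_equiv delta_mia"
    by (auto simp: mia_equiv_def delta_mia_simps equiv_def refl_on_def)
qed

lemma mia_equiv_class: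
  "v \<in> verts Q \<Longrightarrow> i \<in> {-1, 1} \<Longrightarrow> mia_equiv delta_mia `` {Triv v i} = vertex_class v"
  by (auto simp: mia_equiv_delta_mia vertex_class_def zero_strings_def)

text \<open>
  The two end functions are those of the target quiver, which also fixes their values off the arrows,
  so that applying the isomorphism to \<open>Q\<close> yields the quiver of the automaton as a record.
\<close>

definition string_iso ::
  "('v, 'a, ('v, 'a) strng set, ('v, 'a) strng \<times> ('v, 'a) strng) digraph_isomorphism" where
  "string_iso = \<lparr>iso_verts = vertex_class, iso_arcs = string_arrow,
     iso_head = head (mia_quiver delta_mia), iso_tail = tail (mia_quiver delta_mia)\<rparr>"

lemma arcs_mia_quiver: "arcs (mia_quiver delta_mia) = string_arrow ` arcs Q"
proof (intro equalityI subsetI)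
  fix a
  assume "a \<in> string_arrow ` arcs Q"
  then obtain \<beta> where "\<beta> \<in> arcs Q" "a = string_arrow \<beta>"
    by blast
  then show "a \<in> arcs (mia_quiver delta_mia)"
    using delta_step_Triv sigma_sign eps_sign
    by (auto simp: mia_quiver_def delta_mia_simps string_arrow_def zero_strings_def)
next
  fix a
  assume "a \<in> arcs (mia_quiver delta_mia)"
  then obtain x y where xy: "a = (x, entry delta_mia y)" "x \<in> zero_strings"
    "step delta_mia x (Dir 0) = Some y"
    by (auto simp: mia_quiver_def delta_mia_simps)
  then obtain v i where x: "x = Triv v i"
    by (auto simp: zero_strings_def)
  obtain \<beta> where "step string_mia x (Dir \<beta>) \<noteq> None"
    using delta_step_defined xy(3) by force
  then have \<beta>: "\<beta> \<in> arcs Q" "x = Triv (tail Q \<beta>) (- \<sigma> \<beta>)"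
    unfolding x string_step_Triv by auto
  then have "y = Word [Dir \<beta>]"
    using delta_step_Triv[OF \<beta>(1)] xy(3) by simp
  then show "a \<in> string_arrow ` arcs Q"
    using \<beta> by (auto simp: xy(1) string_arrow_def delta_mia_simps)
qed

lemma mia_quiver_ends:
  assumes "\<alpha> \<in> arcs Q"
  shows "tail (mia_quiver delta_mia) (string_arrow \<alpha>) = vertex_class (tail Q \<alpha>)"
    and "head (mia_quiver delta_mia) (string_arrow \<alpha>) = vertex_class (head Q \<alpha>)"
  using assms sigma_sign[OF assms] eps_sign[OF assms]
  by (auto simp: mia_quiver_def string_arrow_def intro!: mia_equiv_class)

lemma digraph_isomorphism_string_iso: "digraph_isomorphism string_iso"
proof -
  have "inj_on vertex_class (verts Q)"
    by (auto simp: inj_on_def vertex_class_def doubleton_eq_iff)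
  moreover have "inj_on string_arrow (arcs Q)"
    by (auto simp: inj_on_def string_arrow_def intro: sigma_injective)
  ultimately show ?thesis
    using wf_digraph_axioms by (simp add: digraph_isomorphism_def string_iso_def mia_quiver_ends)
qed

lemma app_iso_string_iso: "app_iso string_iso Q = mia_quiver delta_mia"
proof -
  have "vertex_class v \<in> verts (mia_quiver delta_mia)" if "v \<in> verts Q" for v
    using quotientI[of "Triv v 1" zero_strings "mia_equiv delta_mia"] mia_equiv_class[OF that, of 1] that
    by (simp add: mia_quiver_def delta_mia_simps zero_strings_def)
  then have "verts (mia_quiver delta_mia) = vertex_class ` verts Q"
    by (auto simp: mia_quiver_def quotient_def delta_mia_simps zero_strings_def mia_equiv_class)
  then show ?thesis
    by (intro pre_digraph.equality) (simp_all add: string_iso_def arcs_mia_quiver)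
qed

text \<open>
  A mismatch of initial states inside the path of automaton arrows is a mismatch of the signs \<open>\<epsilon>\<close> and
  \<open>- \<sigma>\<close> of two consecutive arrows of \<open>p\<close>. Permitted paths have none, since two consecutive arrows
  that are not a relation have matching signs.
\<close>

lemma mia_relations_iff:
  assumes walk: "\<exists>u v. awalk u p v"
  shows "map string_arrow p \<in> mia_relations delta_mia \<longleftrightarrow> (\<exists>r\<in>\<rho>. sublist r p)"
proof (cases "length p \<ge> 2")
  case False
  then have "\<not> sublist r p" if "r \<in> \<rho>" for r
    using rel_length[OF that] by (auto dest: sublist_length_le)
  then show ?thesis
    using False by (auto simp: mia_relations_def)
next
  case True
  then have "p \<noteq> []"
    by auto
  have arcs: "set p \<subseteq> arcs Q" and heads: "successively (\<lambda>a b. head Q a = tail Q b) p"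
    using walk \<open>p \<noteq> []\<close> by (simp_all add: ex_awalk_iff)
  have "\<exists>u v. pre_digraph.awalk (mia_quiver delta_mia) u (map string_arrow p) v"
    using walk awalk_app_isoI[OF _ digraph_isomorphism_string_iso]
    unfolding app_iso_string_iso by (simp add: string_iso_def) blast
  moreover have "(\<exists>i. Suc i < length p \<and> snd (map string_arrow p ! i) \<noteq> fst (map string_arrow p ! Suc i)) \<longleftrightarrow>
      \<not> successively (\<lambda>\<alpha> \<beta>. \<epsilon> \<alpha> = - \<sigma> \<beta>) p"
    using heads by (auto simp: successively_conv_nth string_arrow_def)
  ultimately have "map string_arrow p \<in> mia_relations delta_mia \<longleftrightarrow>
      run p = None \<or> \<not> successively (\<lambda>\<alpha> \<beta>. \<epsilon> \<alpha> = - \<sigma> \<beta>) p"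
    using True \<open>p \<noteq> []\<close> by (simp add: mia_relations_def hd_map)
  also have "\<dots> \<longleftrightarrow> \<not> permitted p"
  proof -
    have "successively (\<lambda>\<alpha> \<beta>. \<epsilon> \<alpha> = - \<sigma> \<beta>) p" if "permitted p"
      unfolding successively_conv_nth
    proof (intro allI impI)
      fix i
      assume i: "Suc i < length p"
      then show "\<epsilon> (p ! i) = - \<sigma> (p ! Suc i)"
        using permitted_consecutive[OF that i] arcs by (intro eps_sigma) auto
    qed
    then show ?thesis
      using permitted_if_run[OF walk \<open>p \<noteq> []\<close>] run_permitted[OF _ \<open>p \<noteq> []\<close>] by (metis option.distinct(1))
  qed
  also have "\<dots> \<longleftrightarrow> (\<exists>r\<in>\<rho>. sublist r p)"
    using walk by (simp add: permitted_def)
  finally show ?thesis .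
qed

section \<open>The isomorphism\<close>

theorem mia_algebra_isomorphic:
  "(bound_quiver_algebra (mia_quiver delta_mia) (mia_relations delta_mia) ::
      ('k::field, (('v, 'a) strng set \<times> (('v, 'a) strng \<times> ('v, 'a) strng) list \<Rightarrow>\<^sub>0 'k) set) module)
   \<cong>\<^sub>a\<^sub>l\<^sub>g bound_quiver_algebra Q \<rho>"
proof -
  \<comment> \<open>The renaming is applied backwards, so that the two sets of relations are compared in \<open>Q\<close>.\<close>
  let ?\<phi> = "inv_iso string_iso"
  let ?R = "map (iso_arcs ?\<phi>) ` mia_relations delta_mia"
  note iso = digraph_isomorphism_string_iso
  interpret M: fin_digraph "mia_quiver delta_mia"
    using fin_digraphI_app_iso[OF iso] by (simp only: app_iso_string_iso)
  have inv: "M.digraph_isomorphism ?\<phi>" and Q: "app_iso ?\<phi> (mia_quiver delta_mia) = Q"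
    using digraph_isomorphism_invI[OF iso] app_iso_inv[OF iso] by (simp_all only: app_iso_string_iso)
  have arrow_inv: "map (iso_arcs ?\<phi>) (map string_arrow p) = p" if "set p \<subseteq> arcs Q" for p
  proof -
    have "iso_arcs ?\<phi> (string_arrow \<alpha>) = \<alpha>" if "\<alpha> \<in> arcs Q" for \<alpha>
      using iso_arcs_inv_iso[OF iso that] by (simp add: string_iso_def)
    then show ?thesis
      using that by (auto intro!: map_idI)
  qed
  have R: "?R = {p. (\<exists>u v. awalk u p v) \<and> (\<exists>r\<in>\<rho>. sublist r p)}"
  proof (intro equalityI subsetI)
    fix p
    assume "p \<in> ?R"
    then obtain w where "w \<in> mia_relations delta_mia" "p = map (iso_arcs ?\<phi>) w"
      by blast
    moreover from this obtain u v where "M.awalk u w v"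
      by (auto simp: mia_relations_def)
    ultimately have w: "w \<in> mia_relations delta_mia" "p = map (iso_arcs ?\<phi>) w" "M.awalk u w v"
      .
    have walk: "\<exists>u v. awalk u p v"
      using M.awalk_app_isoI[OF w(3) inv] unfolding Q w(2) by blast
    have "set w \<subseteq> string_arrow ` arcs Q"
      using w(3) by (simp add: M.awalk_def arcs_mia_quiver)
    then have "w \<in> lists (string_arrow ` arcs Q)"
      by (simp add: lists_eq_set)
    then obtain q where q: "w = map string_arrow q" "set q \<subseteq> arcs Q"
      unfolding lists_image by (metis imageE in_listsD subsetI)
    then have "map string_arrow p = w"
      using arrow_inv[OF q(2)] by (simp only: w(2))
    then show "p \<in> {p. (\<exists>u v. awalk u p v) \<and> (\<exists>r\<in>\<rho>. sublist r p)}"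
      using walk mia_relations_iff[OF walk] w(1) by simp
  next
    fix p
    assume "p \<in> {p. (\<exists>u v. awalk u p v) \<and> (\<exists>r\<in>\<rho>. sublist r p)}"
    then have p: "\<exists>u v. awalk u p v" "\<exists>r\<in>\<rho>. sublist r p"
      by simp_all
    then have "map string_arrow p \<in> mia_relations delta_mia"
      using mia_relations_iff by blast
    moreover have "set p \<subseteq> arcs Q"
      using p(1) by auto
    ultimately show "p \<in> ?R"
      using arrow_inv by (metis image_eqI)
  qed
  have walks: "w \<noteq> [] \<and> (\<exists>u v. M.awalk u w v)" if "w \<in> mia_relations delta_mia" for w
    using that by (auto simp: mia_relations_def)
  have "(bound_quiver_algebra (mia_quiver delta_mia) (mia_relations delta_mia) :: ('k, _) module) \<cong>\<^sub>a\<^sub>l\<^sub>g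
      (bound_quiver_algebra Q ?R :: ('k, _) module)"
    using M.bound_quiver_algebra_app_iso[OF inv walks] unfolding Q .
  also have "(bound_quiver_algebra Q ?R :: ('k, _) module) = bound_quiver_algebra Q \<rho>"
  proof -
    have "genideal (path_algebra Q :: ('k, _) module) (relators Q ?R) =
        genideal (path_algebra Q) (relators Q \<rho>)"
      unfolding R using rel_path rel_length by (intro genideal_relators_sublist_closure) fastforce+
    then show ?thesis
      by (simp add: bound_quiver_algebra_def relators_def)
  qed
  finally show ?thesis .
qed

end

theorem theorem7p3:
  fixes Q :: "('v, 'a) pre_digraph" and \<rho> :: "'a list set" and \<sigma> \<epsilon> :: "'a \<Rightarrow> int"
  assumes "signed_string_algebra Q \<rho> \<sigma> \<epsilon>"
    and "arcs Q \<noteq> {}"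
  defines "M \<equiv> signed_string_algebra.delta_mia Q \<rho> \<sigma> \<epsilon>"
  shows "(bound_quiver_algebra (mia_quiver M) (mia_relations M) ::
            ('k::alg_closed_field, (('v, 'a) strng set \<times> (('v, 'a) strng \<times> ('v, 'a) strng) list \<Rightarrow>\<^sub>0 'k) set) module)
         \<cong>\<^sub>a\<^sub>l\<^sub>g (bound_quiver_algebra Q \<rho> :: ('k, ('v \<times> 'a list \<Rightarrow>\<^sub>0 'k) set) module)"
  unfolding M_def using signed_string_algebra.mia_algebra_isomorphic[OF assms(1)] .

end
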